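(* Let $G=(V,E)$ be a finite simple strongly connected directed graph. Then $$F_{\mathcal TG}=\Phi_G\,F_G,\qquad \Phi_G=\prod_{\substack{W\subsetneq V\\ W\text{ strongly connected}}}\left(\Psi_{V\setminus W}\right)^{m(W)},$$ where the product is over all nonempty proper strongly connected subsets $W$ of $V$.
   Context: $G=(V,E)$ is a finite simple directed graph with edge indeterminates $x_e$. A spanning tree of $G$ is a subgraph on all vertices, with no cycle, one vertex (root) of outdegree $0$ and all others of outdegree $1$. For nonempty $U\subseteq V$, a forest rooted in $U$ is a subgraph on all vertices with no cycle in which vertices of $U$ have outdegree $0$ and all others outdegree $1$. The weight of a tree or forest is the product of $x_e$ over its edges. The tree graph $\mathcal TG$: its vertices are the spanning trees of $G$; for a tree $\mathbf a$ rooted at $r$ and $e\in E$ with $s(e)=r$, the tree $\mathbf b$ obtained from $\mathbf a$ by adding $e$ and deleting the edge of $\mathbf a$ going out of $t(e)$ yields an edge $\mathbf a\to\mathbf b$ of $\mathcal TG$ of weight $x_e$; spanning trees of $\mathcal TG$ (rooted anywhere) are weighted by the product of their edge weights. $F_G$ (resp. $F_{\mathcal TG}$) is the sum of weights of all spanning trees of $G$ (resp. $\mathcal TG$), and $\Psi_U$ is the sum of weights of all forests of $G$ rooted in $U$. Exploration algorithm (depends on a fixed total order of $V$). Input: a spanning tree $\mathbf a$ rooted at $v$. Initialize $A=\{v\}$, $F=\{e: s(e)\neq v\}$, $\mathbf L$ = FIFO list of edges with target $v$, by increasing source. While $\mathbf L$ is nonempty, take its first edge $e$, with source $w$: if $e\in\mathbf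 a$, add $w$ to $A$, delete from $\mathbf L$ (and $F$) all edges with source $w$, and append to $\mathbf L$ all edges of $F$ with target $w$ by increasing source; otherwise delete from $\mathbf L$ and $F$ all edges with source or target $w$. At the end $\phi(\mathbf a)=A$ and $\psi(\mathbf a)$ is the strongly connected component of $v$ in the induced graph $G_{\phi(\mathbf a)}$. For $W$ strongly connected and $w\in W$, $m(W,w)$ is the number of spanning trees $\mathbf a$ rooted at $w$ with $\psi(\mathbf a)=W$; $m(W)$ denotes this number, which is independent of $w\in W$. *)

theory Defs
  imports Main "HOL-Library.While_Combinator"
begin

text \<open>Digraphs: vertex set V, edge set E of pairs (source, target).
  Finite simple: V finite, E \<subseteq> V \<times> V, no loops.\<close>

definition simple_digraph :: "'v set \<Rightarrow> ('v \<times> 'v) set \<Rightarrow> bool" where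
  "simple_digraph V E \<longleftrightarrow> finite V \<and> E \<subseteq> V \<times> V \<and> (\<forall>v. (v, v) \<notin> E)"

definition outdeg :: "('v \<times> 'v) set \<Rightarrow> 'v \<Rightarrow> nat" where
  "outdeg T v = card {e \<in> T. fst e = v}"

text \<open>Spanning tree rooted at r.\<close>
definition is_sptree :: "'v set \<Rightarrow> ('v \<times> 'v) set \<Rightarrow> ('v \<times> 'v) set \<Rightarrow> 'v \<Rightarrow> bool" where
  "is_sptree V E T r \<longleftrightarrow> T \<subseteq> E \<and> r \<in> V \<and> acyclic T \<and>
     (\<forall>v\<in>V. outdeg T v = (if v = r then 0 else 1))"

definition sptrees :: "'v set \<Rightarrow> ('v \<times> 'v) set \<Rightarrow> ('v \<times> 'v) set set" where
  "sptrees V E = {T. \<exists>r. is_sptree V E T r}"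

text \<open>Forest rooted in U.\<close>
definition is_forest :: "'v set \<Rightarrow> ('v \<times> 'v) set \<Rightarrow> 'v set \<Rightarrow> ('v \<times> 'v) set \<Rightarrow> bool" where
  "is_forest V E U T \<longleftrightarrow> T \<subseteq> E \<and> acyclic T \<and>
     (\<forall>v\<in>V. outdeg T v = (if v \<in> U then 0 else 1))"

definition weight :: "('e \<Rightarrow> 'a::comm_semiring_1) \<Rightarrow> 'e set \<Rightarrow> 'a" where
  "weight x T = (\<Prod>e\<in>T. x e)"

definition F_G :: "'v set \<Rightarrow> ('v \<times> 'v) set \<Rightarrow> ('v \<times> 'v \<Rightarrow> 'a::comm_semiring_1) \<Rightarrow> 'a" where
  "F_G V E x = (\<Sum>T\<in>sptrees V E. weight x T)"

definition Psi :: "'v set \<Rightarrow> ('v \<times> 'v) set \<Rightarrow> ('v \<times> 'v \<Rightarrow> 'a::comm_semiring_1) \<Rightarrow> 'v set \<Rightarrow> 'a" where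
  "Psi V E x U = (\<Sum>T\<in>{T. is_forest V E U T}. weight x T)"

text \<open>Tree graph: vertices are spanning trees; edge a \<rightarrow> b for a rooted at r and
  e \<in> E with source r, where b = a + e - (edge of a leaving t(e)).\<close>
definition tg_edges :: "'v set \<Rightarrow> ('v \<times> 'v) set \<Rightarrow> (('v \<times> 'v) set \<times> ('v \<times> 'v) set) set" where
  "tg_edges V E = {(a, b). \<exists>r e. is_sptree V E a r \<and> e \<in> E \<and> fst e = r \<and>
      b = insert e (a - {f \<in> a. fst f = snd e})}"

text \<open>The weight of the tree-graph edge a \<rightarrow> b is x_e, where e is the unique
  edge of G added, i.e. b - a = {e}.\<close>
definition tg_weight :: "('v \<times> 'v \<Rightarrow> 'a::comm_semiring_1) \<Rightarrow> ('v \<times> 'v) set \<times> ('v \<times> 'v) set \<Rightarrow> 'a" where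
  "tg_weight x p = x (THE e. snd p - fst p = {e})"

definition F_TG :: "'v set \<Rightarrow> ('v \<times> 'v) set \<Rightarrow> ('v \<times> 'v \<Rightarrow> 'a::comm_semiring_1) \<Rightarrow> 'a" where
  "F_TG V E x = (\<Sum>T\<in>sptrees (sptrees V E) (tg_edges V E). weight (tg_weight x) T)"

text \<open>Strongly connected subset W: nonempty and the induced graph G_W is strongly connected.\<close>
definition strongly_connected :: "('v \<times> 'v) set \<Rightarrow> 'v set \<Rightarrow> bool" where
  "strongly_connected E W \<longleftrightarrow> W \<noteq> {} \<and>
     (\<forall>u\<in>W. \<forall>v\<in>W. (u, v) \<in> (E \<inter> (W \<times> W))\<^sup>*)"

text \<open>Exploration algorithm. State (A, F, L); the vertex order is the linorder on 'v.\<close>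
definition in_edges_sorted :: "('v::linorder \<times> 'v) set \<Rightarrow> 'v \<Rightarrow> ('v \<times> 'v) list" where
  "in_edges_sorted F w = map (\<lambda>u. (u, w)) (sorted_list_of_set {u. (u, w) \<in> F})"

definition explore_step ::
  "('v::linorder \<times> 'v) set \<Rightarrow> 'v set \<times> ('v \<times> 'v) set \<times> ('v \<times> 'v) list
     \<Rightarrow> 'v set \<times> ('v \<times> 'v) set \<times> ('v \<times> 'v) list" where
  "explore_step a st = (case st of (A, F, L) \<Rightarrow>
     (let e = hd L; w = fst e in
      if e \<in> a then
        (let F' = {f \<in> F. fst f \<noteq> w};
             L' = filter (\<lambda>f. fst f \<noteq> w) L @ in_edges_sorted F' w
         in (insert w A, F', L'))
      else
        (A, {f \<in> F. fst f \<noteq> w \<and> snd f \<noteq> w},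
            filter (\<lambda>f. fst f \<noteq> w \<and> snd f \<noteq> w) L)))"

definition explore_init ::
  "('v::linorder \<times> 'v) set \<Rightarrow> 'v \<Rightarrow> 'v set \<times> ('v \<times> 'v) set \<times> ('v \<times> 'v) list" where
  "explore_init E v = ({v}, {e \<in> E. fst e \<noteq> v}, in_edges_sorted E v)"

text \<open>phi(a) for a spanning tree a rooted at v.\<close>
definition phi :: "('v::linorder \<times> 'v) set \<Rightarrow> ('v \<times> 'v) set \<Rightarrow> 'v \<Rightarrow> 'v set" where
  "phi E a v = fst (the (while_option (\<lambda>(A, F, L). L \<noteq> []) (explore_step a) (explore_init E v)))"

text \<open>psi(a): strongly connected component of v in the induced graph G_{phi(a)}.\<close>
definition psi :: "('v::linorder \<times> 'v) set \<Rightarrow> ('v \<times> 'v) set \<Rightarrow> 'v \<Rightarrow> 'v set" where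
  "psi E a v = (let A = phi E a v; R = E \<inter> (A \<times> A) in
     {u \<in> A. (v, u) \<in> R\<^sup>* \<and> (u, v) \<in> R\<^sup>*})"

definition m_at :: "'v::linorder set \<Rightarrow> ('v \<times> 'v) set \<Rightarrow> 'v set \<Rightarrow> 'v \<Rightarrow> nat" where
  "m_at V E W w = card {a. is_sptree V E a w \<and> psi E a w = W}"

text \<open>m(W) = m(W,w) for an (arbitrary) w \<in> W; independent of w by the paper.\<close>
definition m :: "'v::linorder set \<Rightarrow> ('v \<times> 'v) set \<Rightarrow> 'v set \<Rightarrow> nat" where
  "m V E W = m_at V E W (SOME w. w \<in> W)"

definition Phi_G :: "'v::linorder set \<Rightarrow> ('v \<times> 'v) set \<Rightarrow> ('v \<times> 'v \<Rightarrow> 'a::comm_semiring_1) \<Rightarrow> 'a" where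
  "Phi_G V E x = (\<Prod>W\<in>{W. W \<subset> V \<and> strongly_connected E W}. Psi V E x (V - W) ^ m V E W)"

end

theory Submission
  imports Defs "Jordan_Normal_Form.Schur_Decomposition" "HOL-Computational_Algebra.Primes"
begin

text \<open>
  Both sides are polynomials with natural coefficients, so it suffices to compare them over the
  complex numbers. A walk of the root lifts uniquely to the tree graph, and it replaces the edges
  leaving the visited vertices by the last exits of the walk. A closed walk with support \<open>S\<close>
  therefore fixes exactly as many trees as there are forests rooted in \<open>S\<close>. The exploration
  algorithm shows that this number is the sum of \<open>m(W)\<close> over the strongly connected
  \<open>W \<supseteq> S\<close>. Hence the powers of the Laplacian of the tree graph have the same traces as those of
  the direct sum of \<open>m(W)\<close> copies of the Laplacian of \<open>G\<close> restricted to \<open>W\<close>, over all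
  strongly connected \<open>W\<close>, and the characteristic polynomials agree. By the matrix-tree theorem, the
  identity follows by comparing their linear coefficients, because \<open>m(V) = 1\<close> and the constant
  coefficient for \<open>W = V\<close> is zero.
\<close>

section \<open>Forests\<close>

text \<open>No bijection between the spanning trees of the tree graph and the terms of the product
  is built; the comparison is spectral. Recovering eigenvalues from traces of powers uses
  characteristic zero and a full set of eigenvalues, which explains the complex numbers; the way
  back works because a polynomial with natural coefficients is a multiset of monomials and can be
  evaluated in any commutative semiring. The Laplacian restricted to \<open>W\<close> keeps the full
  out-weights on its diagonal, including edges that leave \<open>W\<close>. That is why its constant
  coefficient is \<open>Psi\<close> at \<open>V - W\<close> and not a quantity of the induced graph.
  The diagonal also forces walks that may stand still. The exploration enters the trace computation
  through a single identity, the sum of \<open>m\<close> over the strongly connected supersets of a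
  strongly connected \<open>S\<close>. Supports of closed walks are of this kind, and a walk stays
  in \<open>W\<close> exactly when its support does, so exchanging the sums over walks and over
  \<open>W\<close> assembles the traces of the restricted Laplacians. The same identity determines
  \<open>m\<close> from larger sets to smaller ones, which makes it independent of the base
  vertex.\<close>

lemma outdeg_eq_0_iff: "finite T \<Longrightarrow> outdeg T v = 0 \<longleftrightarrow> v \<notin> Domain T"
  unfolding outdeg_def by (auto simp: Domain_iff)

lemma outdeg_eq_1_iff: "outdeg T v = 1 \<longleftrightarrow> (\<exists>!w. (v, w) \<in> T)"
proof -
  have "{e \<in> T. fst e = v} = Pair v ` {w. (v, w) \<in> T}"
    by auto
  then have "outdeg T v = card {w. (v, w) \<in> T}"
    unfolding outdeg_def by (simp add: card_image inj_on_def)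
  then show ?thesis
    by (auto simp: card_1_singleton_iff set_eq_iff Ex1_def)
qed

text \<open>The vertex type carries no order here, so that the matrix-tree results also apply to the
  tree graph, whose vertices are edge sets.\<close>

locale finite_digraph =
  fixes V :: "'v set" and E :: "('v \<times> 'v) set"
  assumes finite_V: "finite V" and E_subset: "E \<subseteq> V \<times> V"
begin

lemma finite_E: "finite E"
  using finite_V E_subset finite_subset by blast

text \<open>Trades degree counts for a partial function with domain \<open>V - U\<close>; later
  constructions check this form.\<close>

lemma forest_iff_acyclic:
  "is_forest V E U T \<longleftrightarrow> T \<subseteq> E \<and> single_valued T \<and> Domain T = V - U \<and> acyclic T"
proof (cases "T \<subseteq> E")
  case True
  then have fin: "finite T" and dom: "Domain T \<subseteq> V"
    using finite_E finite_subset E_subset by blast+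
  have "(\<forall>v\<in>V. outdeg T v = (if v \<in> U then 0 else 1)) \<longleftrightarrow>
    (\<forall>v\<in>V. if v \<in> U then v \<notin> Domain T else (\<exists>!w. (v, w) \<in> T))"
    using outdeg_eq_0_iff[OF fin] outdeg_eq_1_iff[of T] by (simp only: split: if_split)
  also have "\<dots> \<longleftrightarrow> single_valued T \<and> Domain T = V - U"
    using dom unfolding single_valued_def by (auto split: if_splits; blast)
  finally show ?thesis
    unfolding is_forest_def by auto
qed (auto simp: is_forest_def)

text \<open>A finite acyclic relation has a well-founded converse, so following out-edges stops, and
  it can only stop in \<open>U\<close>.\<close>

lemma forest_reaches_root:
  assumes "is_forest V E U T" and "u \<in> V"
  shows "\<exists>r\<in>U. (u, r) \<in> T\<^sup>*"
proof -
  have T: "T \<subseteq> E" "Domain T = V - U" "acyclic T"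
    using assms(1) forest_iff_acyclic by auto
  then have "wf (T\<inverse>)"
    using finite_E finite_subset finite_acyclic_wf_converse by blast
  then show ?thesis
    using assms(2)
  proof (induction u rule: wf_induct_rule)
    case (less u)
    show ?case
    proof (cases "u \<in> U")
      case False
      then obtain w where w: "(u, w) \<in> T"
        using T(2) less.prems by blast
      then have "w \<in> V"
        using T(1) E_subset by auto
      then show ?thesis
        using less.IH[of w] w by (auto intro: converse_rtrancl_into_rtrancl)
    qed auto
  qed
qed

text \<open>Acyclicity is hard to check for a union of edge sets, reachability of the roots is easy.
  It suffices because a cycle would trap the unique path starting on it, while roots have no
  out-edge.\<close>

lemma forestI_reach:
  assumes "T \<subseteq> E" "single_valued T" "Domain T = V - U"
    and reach: "\<And>u. u \<in> V \<Longrightarrow> \<exists>r\<in>U. (u, r) \<in> T\<^sup>*"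
  shows "is_forest V E U T"
proof -
  have "acyclic T"
    unfolding acyclic_def
  proof (intro allI notI)
    fix u assume u: "(u, u) \<in> T\<^sup>+"
    then have "u \<in> V"
      using assms(3) by (auto dest: tranclD)
    then obtain r where r: "r \<in> U" "(u, r) \<in> T\<^sup>*"
      using reach by blast
    \<comment> \<open>Successors are unique, so lying on a cycle passes from each vertex of the path
      to the next, up to the root \<open>r\<close>.\<close>
    from r(2) u have "(r, r) \<in> T\<^sup>+"
    proof (induction rule: rtrancl_induct)
      case (step y z)
      then obtain z' where "(y, z') \<in> T" "(z', y) \<in> T\<^sup>*"
        by (meson tranclD)
      moreover from this have "z' = z"
        using step.hyps(2) assms(2) by (auto dest: single_valuedD)
      ultimately show ?case
        using step.hyps(2) by (auto intro: rtrancl_into_trancl1)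
    qed
    then show False
      using r(1) assms(3) by (auto dest: tranclD)
  qed
  then show ?thesis
    using assms forest_iff_acyclic by auto
qed

lemma is_sptree_iff_forest: "is_sptree V E T r \<longleftrightarrow> r \<in> V \<and> is_forest V E {r} T"
  unfolding is_sptree_def is_forest_def by auto

lemma finite_forests: "finite {T. is_forest V E U T}"
  by (rule finite_subset[of _ "Pow E"]) (auto simp: is_forest_def finite_E)

lemma finite_sptrees: "finite (sptrees V E)"
  by (rule finite_subset[of _ "Pow E"]) (auto simp: sptrees_def is_sptree_def finite_E)

lemma finite_rooted_trees: "finite {T. is_sptree V E T r}"
  by (rule finite_subset[OF _ finite_sptrees]) (auto simp: sptrees_def)

lemma sptree_root_unique:
  assumes "is_sptree V E T r" "is_sptree V E T s"
  shows "r = s"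
  using assms unfolding is_sptree_iff_forest forest_iff_acyclic by blast

lemma forest_restrict:
  assumes "is_forest V E U T" "U \<subseteq> S"
  shows "is_forest V E S {f \<in> T. fst f \<notin> S}"
proof -
  have "acyclic {f \<in> T. fst f \<notin> S}"
    using assms(1) forest_iff_acyclic by (metis (no_types, lifting) acyclic_subset mem_Collect_eq subsetI)
  then show ?thesis
    using assms unfolding forest_iff_acyclic single_valued_def by (auto simp: Domain_iff set_eq_iff)
qed

end

section \<open>The exploration\<close>

text \<open>The sets \<open>C\<close> and \<open>R\<close> record the accepted and the rejected edges, and \<open>A'\<close> is the final vertex
  set. The oracle \<open>a\<close> need not be a tree.\<close>

inductive explores ::
  "('v::linorder \<times> 'v) set \<Rightarrow> 'v set \<times> ('v \<times> 'v) set \<times> ('v \<times> 'v) list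
    \<Rightarrow> ('v \<times> 'v) set \<Rightarrow> ('v \<times> 'v) set \<Rightarrow> 'v set \<Rightarrow> bool" for a where
  finish: "explores a (A, F, []) {} {} A"
| accept: "e \<in> a \<Longrightarrow> explores a (explore_step a (A, F, e # L)) C R A'
    \<Longrightarrow> explores a (A, F, e # L) (insert e C) R A'"
| reject: "e \<notin> a \<Longrightarrow> explores a (explore_step a (A, F, e # L)) C R A'
    \<Longrightarrow> explores a (A, F, e # L) C (insert e R) A'"

lemma explores_deterministic:
  assumes "explores a st C R A" "explores a st C' R' A'"
  shows "C = C' \<and> R = R' \<and> A = A'"
  using assms
proof (induction arbitrary: C' R' A' rule: explores.induct)
  case (finish A F)
  then show ?case by (auto elim: explores.cases)
next
  case (accept e A F L C R A')
  from accept.prems accept.hyps(1) show ?case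
    by (cases rule: explores.cases) (use accept.IH in blast)+
next
  case (reject e A F L C R A')
  from reject.prems reject.hyps(1) show ?case
    by (cases rule: explores.cases) (use reject.IH in blast)+
qed

text \<open>A run consults the oracle only on the edges it accepts or rejects, so any oracle that
  answers alike on these reproduces it.\<close>

lemma explores_change_oracle:
  assumes "explores a st C R A" "C \<subseteq> b" "R \<inter> b = {}"
  shows "explores b st C R A"
  using assms
proof (induction rule: explores.induct)
  case (finish A F)
  show ?case by (rule explores.finish)
next
  case (accept e A F L C R A')
  moreover have "explore_step b (A, F, e # L) = explore_step a (A, F, e # L)"
    using accept unfolding explore_step_def by simp
  ultimately show ?case
    by (auto intro!: explores.accept)
next
  case (reject e A F L C R A')
  moreover have "explore_step b (A, F, e # L) = explore_step a (A, F, e # L)"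
    using reject unfolding explore_step_def by simp
  ultimately show ?case
    by (auto intro!: explores.reject)
qed

lemma explores_while_option:
  assumes "explores a st C R A"
  shows "fst (the (while_option (\<lambda>(A, F, L). L \<noteq> []) (explore_step a) st)) = A"
  using assms
  by (induction rule: explores.induct; subst while_option_unfold; simp)

text \<open>Here \<open>D\<close> is the set of sources of the edges rejected so far.\<close>

definition explore_inv ::
  "('v \<times> 'v) set \<Rightarrow> 'v set \<Rightarrow> 'v set \<times> ('v \<times> 'v) set \<times> ('v \<times> 'v) list \<Rightarrow> bool" where
  "explore_inv E D st \<longleftrightarrow> (case st of (A, F, L) \<Rightarrow>
     A \<inter> D = {} \<and> F = {f \<in> E. fst f \<notin> A \<union> D \<and> snd f \<notin> D} \<and> set L = {f \<in> F. snd f \<in> A})"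

lemma set_in_edges_sorted:
  assumes "finite F"
  shows "set (in_edges_sorted F w) = {f \<in> F. snd f = w}"
proof -
  have "finite {u. (u, w) \<in> F}"
    by (rule finite_subset[of _ "fst ` F"]) (use assms in force)+
  then show ?thesis
    unfolding in_edges_sorted_def by auto
qed

text \<open>Looplessness matters: \<open>explore_init\<close> lists all in-edges of
  \<open>v\<close>, and a loop at \<open>v\<close> would be listed although its source is already
  explored.\<close>

lemma explore_inv_init:
  assumes "finite E" "\<forall>u. (u, u) \<notin> E"
  shows "explore_inv E {} (explore_init E v)"
  using assms unfolding explore_inv_def explore_init_def
  by (auto simp: set_in_edges_sorted)

lemma explore_inv_accept:
  assumes "finite E" "explore_inv E D (A, F, e # L)" "e \<in> a"
  shows "explore_inv E D (explore_step a (A, F, e # L))"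
proof -
  obtain w u where e: "e = (w, u)" by fastforce
  define F' where "F' = {f \<in> F. fst f \<noteq> w}"
  have inv: "A \<inter> D = {}" "F = {f \<in> E. fst f \<notin> A \<union> D \<and> snd f \<notin> D}"
    "set (e # L) = {f \<in> F. snd f \<in> A}"
    using assms(2) unfolding explore_inv_def by auto
  have step: "explore_step a (A, F, e # L) =
    (insert w A, F', filter (\<lambda>f. fst f \<noteq> w) (e # L) @ in_edges_sorted F' w)"
    using assms(3) e unfolding explore_step_def F'_def by (simp add: Let_def)
  have "e \<in> {f \<in> F. snd f \<in> A}"
    using inv(3) by (metis list.set_intros(1))
  then have w: "w \<notin> A \<union> D"
    using inv(2) e by auto
  have "finite F'"
    using assms(1) unfolding F'_def inv(2) by simp
  then have "set (filter (\<lambda>f. fst f \<noteq> w) (e # L) @ in_edges_sorted F' w) =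
      {f \<in> set (e # L). fst f \<noteq> w} \<union> {f \<in> F'. snd f = w}"
    by (simp add: set_in_edges_sorted del: filter.simps)
  also have "\<dots> = {f \<in> F'. snd f \<in> insert w A}"
    unfolding inv(3) F'_def by auto
  finally show ?thesis
    unfolding step explore_inv_def prod.case using inv(1) w
    by (auto simp: F'_def inv(2) simp del: filter.simps)
qed

lemma explore_inv_reject:
  assumes "explore_inv E D (A, F, e # L)" "e \<notin> a"
  shows "explore_inv E (insert (fst e) D) (explore_step a (A, F, e # L))"
proof -
  obtain w u where e: "e = (w, u)" by fastforce
  define F' where "F' = {f \<in> F. fst f \<noteq> w \<and> snd f \<noteq> w}"
  have inv: "A \<inter> D = {}" "F = {f \<in> E. fst f \<notin> A \<union> D \<and> snd f \<notin> D}"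
    "set (e # L) = {f \<in> F. snd f \<in> A}"
    using assms(1) unfolding explore_inv_def by auto
  have step: "explore_step a (A, F, e # L) =
    (A, F', filter (\<lambda>f. fst f \<noteq> w \<and> snd f \<noteq> w) (e # L))"
    using assms(2) e unfolding explore_step_def F'_def by simp
  have "e \<in> {f \<in> F. snd f \<in> A}"
    using inv(3) by (metis list.set_intros(1))
  then have w: "w \<notin> A \<union> D"
    using inv(2) e by auto
  have "set (filter (\<lambda>f. fst f \<noteq> w \<and> snd f \<noteq> w) (e # L)) =
      {f \<in> set (e # L). fst f \<noteq> w \<and> snd f \<noteq> w}"
    by (simp only: set_filter)
  also have "\<dots> = {f \<in> F'. snd f \<in> A}"
    unfolding inv(3) F'_def by auto
  finally show ?thesis
    unfolding step explore_inv_def prod.case using inv(1) w e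
    by (auto simp: F'_def inv(2) simp del: filter.simps)
qed

lemma fst_explore_step:
  "e \<in> a \<Longrightarrow> fst (explore_step a (A, F, e # L)) = insert (fst e) A"
  "e \<notin> a \<Longrightarrow> fst (explore_step a (A, F, e # L)) = A"
  unfolding explore_step_def by (auto simp: Let_def)

text \<open>This is termination: both branches remove the examined edge from \<open>F\<close>, so
  \<open>card F\<close> decreases.\<close>

lemma explores_exists:
  assumes "finite E" "explore_inv E D st"
  shows "\<exists>C R A. explores a st C R A"
  using assms(2)
proof (induction "card (fst (snd st))" arbitrary: st D rule: less_induct)
  case less
  obtain A F L where st: "st = (A, F, L)"
    using prod_cases3 by blast
  show ?case
  proof (cases L)
    case Nil
    then show ?thesis unfolding st by (auto intro: explores.finish)
  next
    case (Cons e L')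
    have inv: "explore_inv E D (A, F, e # L')"
      using less.prems unfolding st Cons .
    then have "finite F" "e \<in> F"
      using assms(1) unfolding explore_inv_def by auto
    moreover have "fst (snd (explore_step a (A, F, e # L'))) \<subseteq> F - {e}"
      unfolding explore_step_def by (auto simp: Let_def)
    ultimately have "card (fst (snd (explore_step a (A, F, e # L')))) < card (fst (snd st))"
      unfolding st by (auto intro!: psubset_card_mono)
    moreover have "\<exists>D'. explore_inv E D' (explore_step a (A, F, e # L'))"
      using explore_inv_accept[OF assms(1) inv] explore_inv_reject[OF inv] by blast
    ultimately obtain C R A' where "explores a (explore_step a (A, F, e # L')) C R A'"
      using less.hyps by blast
    then show ?thesis
      unfolding st Cons
      by (cases "e \<in> a") (use explores.accept[of e a] explores.reject[of e a] in blast)+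
  qed
qed

text \<open>The accepted edges form a forest leading back to the initial vertex set. The last
  conjunct drives the later arguments: an in-neighbour of the final set that was left out must be
  the source of a rejected edge.\<close>

lemma explores_result:
  assumes "finite E" "explores a st C R A'" "explore_inv E D st"
  shows "C \<subseteq> E \<inter> a \<and> R \<inter> a = {} \<and> A' = fst st \<union> fst ` C \<and> single_valued C
    \<and> (fst ` C \<union> fst ` R) \<inter> (fst st \<union> D) = {} \<and> fst ` C \<inter> fst ` R = {}
    \<and> (\<forall>u\<in>A'. \<exists>r\<in>fst st. (u, r) \<in> C\<^sup>*)
    \<and> (\<forall>(u, w)\<in>E. w \<in> A' \<longrightarrow> u \<in> A' \<union> D \<union> fst ` R)"
  using assms(2,3)
proof (induction arbitrary: D rule: explores.induct)
  case (finish A F)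
  then have "A \<inter> D = {}" and F: "F = {f \<in> E. fst f \<notin> A \<union> D \<and> snd f \<notin> D}"
    and L: "{} = {f \<in> F. snd f \<in> A}"
    unfolding explore_inv_def prod.case list.set by blast+
  have "u \<in> A \<union> D" if "(u, w) \<in> E" "w \<in> A" for u w
  proof (rule ccontr)
    assume "u \<notin> A \<union> D"
    then have "(u, w) \<in> {f \<in> F. snd f \<in> A}"
      using that \<open>A \<inter> D = {}\<close> unfolding F by auto
    then show False
      using L by blast
  qed
  then show ?case
    by auto
next
  case (accept e A F L C R A')
  obtain w u where e: "e = (w, u)" by fastforce
  have step: "fst (explore_step a (A, F, e # L)) = insert w A"
    using fst_explore_step(1)[OF accept.hyps(1)] e by simp
  have "e \<in> F" "snd e \<in> A"
    using accept.prems unfolding explore_inv_def by auto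
  then have wu: "w \<notin> A \<union> D" "u \<in> A" "(w, u) \<in> E"
    using accept.prems e unfolding explore_inv_def by auto
  have IH: "C \<subseteq> E \<inter> a" "R \<inter> a = {}" "A' = insert w A \<union> fst ` C" "single_valued C"
    "(fst ` C \<union> fst ` R) \<inter> (insert w A \<union> D) = {}" "fst ` C \<inter> fst ` R = {}"
    "\<forall>u\<in>A'. \<exists>r\<in>insert w A. (u, r) \<in> C\<^sup>*"
    "\<forall>(u, w)\<in>E. w \<in> A' \<longrightarrow> u \<in> A' \<union> D \<union> fst ` R"
    using accept.IH[OF explore_inv_accept[OF assms(1) accept.prems accept.hyps(1)]]
    unfolding step by - (elim conjE, assumption)+
  have notin: "w \<notin> fst ` C \<union> fst ` R"
    using IH(5) by blast
  have "w \<notin> Domain C"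
    using notin by force
  then have sv: "single_valued (insert e C)"
    using IH(4) unfolding e single_valued_def by blast
  have reach: "\<exists>r\<in>A. (z, r) \<in> (insert e C)\<^sup>*" if z: "z \<in> A'" for z
  proof -
    obtain r where r: "r \<in> insert w A" "(z, r) \<in> C\<^sup>*"
      using IH(7) z by metis
    then have zr: "(z, r) \<in> (insert e C)\<^sup>*"
      by (meson in_mono rtrancl_mono subset_insertI)
    \<comment> \<open>A path that ends at the newly accepted \<open>w\<close> is continued by the
      edge \<open>e\<close> into \<open>A\<close>.\<close>
    show ?thesis
    proof (cases "r = w")
      case True
      then have "(z, u) \<in> (insert e C)\<^sup>*"
        using zr e by (auto intro: rtrancl_into_rtrancl)
      then show ?thesis using wu by blast
    qed (use r zr in auto)
  qed
  show ?case
  proof (intro conjI)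
    show "insert e C \<subseteq> E \<inter> a"
      using IH(1) accept.hyps(1) e wu by blast
    show "A' = fst (A, F, e # L) \<union> fst ` insert e C"
      using IH(3) e by simp
    show "(fst ` insert e C \<union> fst ` R) \<inter> (fst (A, F, e # L) \<union> D) = {}"
      using IH(5) wu unfolding e image_insert fst_conv by auto
    show "fst ` insert e C \<inter> fst ` R = {}"
      using IH(6) notin unfolding e image_insert by simp
  qed (use IH sv reach in simp_all)
next
  case (reject e A F L C R A')
  obtain w u where e: "e = (w, u)" by fastforce
  have step: "fst (explore_step a (A, F, e # L)) = A"
    using fst_explore_step(2)[OF reject.hyps(1)] by simp
  have "e \<in> F"
    using reject.prems unfolding explore_inv_def by auto
  then have wu: "w \<notin> A \<union> D"
    using reject.prems e unfolding explore_inv_def by auto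
  have IH: "C \<subseteq> E \<inter> a" "R \<inter> a = {}" "A' = A \<union> fst ` C" "single_valued C"
    "(fst ` C \<union> fst ` R) \<inter> (A \<union> insert w D) = {}" "fst ` C \<inter> fst ` R = {}"
    "\<forall>u\<in>A'. \<exists>r\<in>A. (u, r) \<in> C\<^sup>*"
    "\<forall>(u, z)\<in>E. z \<in> A' \<longrightarrow> u \<in> A' \<union> insert w D \<union> fst ` R"
    using reject.IH[OF explore_inv_reject[OF reject.prems reject.hyps(1)]]
    unfolding step unfolding e fst_conv by - (elim conjE, assumption)+
  show ?case
  proof (intro conjI)
    show "insert e R \<inter> a = {}"
      using IH(2) reject.hyps(1) by blast
    show "(fst ` C \<union> fst ` insert e R) \<inter> (fst (A, F, e # L) \<union> D) = {}"
      using IH(5) wu unfolding e image_insert fst_conv by auto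
    show "fst ` C \<inter> fst ` insert e R = {}"
      using IH(5,6) e unfolding image_insert by auto
    show "\<forall>(u, z)\<in>E. z \<in> A' \<longrightarrow> u \<in> A' \<union> D \<union> fst ` insert e R"
      using IH(8) e by auto
  qed (use IH in simp_all)
qed

locale digraph = finite_digraph V E for V :: "'v::linorder set" and E :: "('v \<times> 'v) set" +
  assumes no_loops: "(v, v) \<notin> E"
begin

lemma obtain_exploration:
  obtains C R where "explores a (explore_init E v) C R (insert v (fst ` C))"
    "C \<subseteq> E \<inter> a" "R \<inter> a = {}" "single_valued C" "v \<notin> fst ` C" "fst ` C \<inter> fst ` R = {}"
    "v \<notin> fst ` R"
    "\<And>u. u \<in> insert v (fst ` C) \<Longrightarrow> (u, v) \<in> C\<^sup>*"
    "\<And>u w. (u, w) \<in> E \<Longrightarrow> w \<in> insert v (fst ` C) \<Longrightarrow> u \<in> insert v (fst ` C) \<union> fst ` R"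
proof -
  have inv: "explore_inv E {} (explore_init E v)"
    using explore_inv_init finite_E no_loops by blast
  obtain C R A' where ex: "explores a (explore_init E v) C R A'"
    using explores_exists[OF finite_E inv] by blast
  note res = explores_result[OF finite_E ex inv]
  have "fst (explore_init E v) = {v}"
    by (simp add: explore_init_def)
  note res = res[unfolded this]
  then have A': "A' = insert v (fst ` C)" by simp
  show ?thesis
    by (rule that[of C R]) (use ex res A' in \<open>simp; blast?\<close>)+
qed

lemma phi_eq: "explores a (explore_init E v) C R A \<Longrightarrow> phi E a v = A"
  unfolding phi_def by (rule explores_while_option)

lemma root_in_phi: "v \<in> phi E a v"
  using obtain_exploration[of a v] phi_eq by (metis insertI1)

section \<open>Trees whose exploration keeps a given set, and forests rooted in that set\<close>

text \<open>If the exploration of a tree keeps all of \<open>S\<close>, it never consults the tree on edges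
  leaving \<open>S\<close>. It can therefore be replayed knowing only the edges leaving the complement of
  \<open>S\<close>, and the replay recovers the deleted edges as the accepted ones.\<close>

lemma bij_betw_trees_forests:
  assumes S: "strongly_connected E S" "v \<in> S" "S \<subseteq> V"
  shows "bij_betw (\<lambda>a. {f \<in> a. fst f \<notin> S})
    {a. is_sptree V E a v \<and> S \<subseteq> phi E a v} {b. is_forest V E S b}"
proof (rule bij_betw_imageI)
  let ?g = "\<lambda>a. {f \<in> a. fst f \<notin> S}"
  let ?T = "{a. is_sptree V E a v \<and> S \<subseteq> phi E a v}"
  \<comment> \<open>The replay oracle \<open>b \<union> S \<times> UNIV\<close> says yes to every
    edge leaving \<open>S\<close> and follows \<open>b\<close> elsewhere. It depends on
    \<open>b\<close> alone, which will give injectivity.\<close>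
  have tree: "a = b \<union> {f \<in> C. fst f \<in> S}"
      "explores (b \<union> S \<times> UNIV) (explore_init E v) C R A"
    if "a \<in> ?T" "explores a (explore_init E v) C R A" "?g a = b" for a b C R A
  proof -
    obtain C' R' where ex: "explores a (explore_init E v) C' R' (insert v (fst ` C'))"
      "C' \<subseteq> E \<inter> a" "R' \<inter> a = {}" "fst ` C' \<inter> fst ` R' = {}" "v \<notin> fst ` R'"
      using obtain_exploration by metis
    have eq: "C' = C" "R' = R" "A = insert v (fst ` C')"
      using explores_deterministic[OF ex(1) that(2)] by auto
    have "S \<subseteq> insert v (fst ` C)"
      using that(1) phi_eq[OF that(2)] eq by auto
    have a: "single_valued a" "Domain a = V - {v}"
      using that(1) is_sptree_iff_forest forest_iff_acyclic by auto
    have "f \<in> C" if f: "f \<in> a" "fst f \<in> S" for f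
    proof -
      have "fst f \<in> Domain a"
        using f(1) by (cases f) auto
      then have "fst f \<in> fst ` C"
        using a(2) f(2) \<open>S \<subseteq> insert v (fst ` C)\<close> by auto
      then obtain g where g: "g \<in> C" "fst g = fst f"
        by auto
      then have "g \<in> a"
        using ex(2) eq by auto
      then have "g = f"
        using a(1) f(1) g(2) by (metis prod.collapse single_valuedD)
      then show ?thesis
        using g(1) by simp
    qed
    \<comment> \<open>The source of a rejected edge is never accepted and is not \<open>v\<close>,
      whereas every vertex of \<open>S\<close> is accepted or equal to \<open>v\<close>.\<close>
    moreover have "fst ` R \<inter> S = {}"
      using \<open>S \<subseteq> insert v (fst ` C)\<close> ex(4,5) eq by auto
    then have "C \<subseteq> ?g a \<union> S \<times> UNIV" "R \<inter> (?g a \<union> S \<times> UNIV) = {}"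
      using ex(2,3) eq by force+
    then have "explores (?g a \<union> S \<times> UNIV) (explore_init E v) C R A"
      by (rule explores_change_oracle[OF that(2)])
    ultimately show "a = b \<union> {f \<in> C. fst f \<in> S}"
      "explores (b \<union> S \<times> UNIV) (explore_init E v) C R A"
      using ex(2) eq that(3) by auto
  qed
  show "inj_on ?g ?T"
  proof (rule inj_onI)
    fix a a' assume a: "a \<in> ?T" and a': "a' \<in> ?T" and eq: "?g a = ?g a'"
    obtain C R A where ex: "explores a (explore_init E v) C R A"
      by (rule obtain_exploration)
    obtain C' R' A' where ex': "explores a' (explore_init E v) C' R' A'"
      by (rule obtain_exploration)
    have "C = C'"
      using explores_deterministic[OF tree(2)[OF a ex eq] tree(2)[OF a' ex' refl]] by simp
    then show "a = a'"
      using tree(1)[OF a ex eq] tree(1)[OF a' ex' refl] by (metis (lifting))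
  qed
  have "?g a \<in> {b. is_forest V E S b}" if "a \<in> ?T" for a
    using that forest_restrict[of "{v}" a S] S(2) is_sptree_iff_forest by auto
  moreover have "b \<in> ?g ` ?T" if b: "is_forest V E S b" for b
  proof -
    obtain C R where ex: "explores (b \<union> S \<times> UNIV) (explore_init E v) C R (insert v (fst ` C))"
      "C \<subseteq> E \<inter> (b \<union> S \<times> UNIV)" "R \<inter> (b \<union> S \<times> UNIV) = {}" "single_valued C" "v \<notin> fst ` C"
      "\<And>u. u \<in> insert v (fst ` C) \<Longrightarrow> (u, v) \<in> C\<^sup>*"
      "\<And>u w. (u, w) \<in> E \<Longrightarrow> w \<in> insert v (fst ` C) \<Longrightarrow> u \<in> insert v (fst ` C) \<union> fst ` R"
      by (rule obtain_exploration[of "b \<union> S \<times> UNIV" v]) (rule that; assumption)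
    \<comment> \<open>The forest is completed by the edges of \<open>C\<close> that leave
      \<open>S\<close>; the other edges of \<open>C\<close> already lie in \<open>b\<close>.\<close>
    define a where "a = b \<union> {f \<in> C. fst f \<in> S}"
    have b': "b \<subseteq> E" "single_valued b" "Domain b = V - S"
      using b forest_iff_acyclic by auto
    have "C \<subseteq> a"
      unfolding a_def using ex(2) by auto
    moreover have "R \<inter> a = {}"
      using ex(3) unfolding a_def by auto
    ultimately have "explores a (explore_init E v) C R (insert v (fst ` C))"
      using ex(1) explores_change_oracle by blast
    then have phi: "phi E a v = insert v (fst ` C)"
      by (rule phi_eq)
    \<comment> \<open>Going backwards from \<open>v\<close> along paths inside \<open>S\<close>:
      each predecessor is accepted or the source of a rejected edge, and the oracle rejects nothing
      that leaves \<open>S\<close>.\<close>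
    have "u \<in> insert v (fst ` C)" if "u \<in> S" for u
    proof -
      have "(u, v) \<in> (E \<inter> S \<times> S)\<^sup>*"
        using S that unfolding strongly_connected_def by auto
      then show ?thesis
      proof (induction rule: converse_rtrancl_induct)
        case (step y z)
        then have "y \<in> insert v (fst ` C) \<union> fst ` R"
          using ex(7) by blast
        moreover have "y \<notin> fst ` R"
          using ex(3) step.hyps(1) by auto
        ultimately show ?case by blast
      qed simp
    qed
    then have SA: "S \<subseteq> insert v (fst ` C)" by blast
    have sv: "single_valued a"
    proof (rule single_valuedI)
      fix u w w' assume uw: "(u, w) \<in> a" "(u, w') \<in> a"
      show "w = w'"
      proof (cases "u \<in> S")
        case True
        then have "(u, w) \<in> C" "(u, w') \<in> C"
          using uw b'(3) unfolding a_def by auto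
        then show ?thesis
          by (rule single_valuedD[OF ex(4)])
      next
        case False
        then have "(u, w) \<in> b" "(u, w') \<in> b"
          using uw unfolding a_def by auto
        then show ?thesis
          by (rule single_valuedD[OF b'(2)])
      qed
    qed
    have dom: "Domain a = V - {v}"
    proof -
      have "Domain a = (V - S) \<union> (S \<inter> fst ` C)"
        using b'(3) unfolding a_def by force
      also have "\<dots> = V - {v}"
        using SA S(2,3) ex(5) by blast
      finally show ?thesis .
    qed
    \<comment> \<open>First \<open>b\<close> leads to some \<open>r\<close> in \<open>S\<close>,
      then the accepted edges lead from \<open>r\<close> to \<open>v\<close>.\<close>
    have reach: "(u, v) \<in> a\<^sup>*" if u: "u \<in> V" for u
    proof -
      obtain r where r: "r \<in> S" "(u, r) \<in> b\<^sup>*"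
        using forest_reaches_root[OF b u] by blast
      have "(r, v) \<in> a\<^sup>*"
        using ex(6)[of r] SA r(1) rtrancl_mono[OF \<open>C \<subseteq> a\<close>] by auto
      moreover have "(u, r) \<in> a\<^sup>*"
        using r(2) rtrancl_mono[of b a] unfolding a_def by auto
      ultimately show ?thesis by simp
    qed
    have "a \<subseteq> E"
      using b'(1) ex(2) unfolding a_def by auto
    then have "is_forest V E {v} a"
      using sv dom reach by (intro forestI_reach) auto
    then have "is_sptree V E a v"
      using S(2,3) unfolding is_sptree_iff_forest by auto
    moreover have "?g a = b"
      using b'(3) unfolding a_def by auto
    ultimately show ?thesis
      using SA phi by (intro image_eqI[of _ _ a]) auto
  qed
  ultimately show "?g ` ?T = {b. is_forest V E S b}" by blast
qed

section \<open>Counting trees by the value of \<open>psi\<close>\<close>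

abbreviation sc_sets :: "'v set set" where
  "sc_sets \<equiv> {W. W \<subseteq> V \<and> strongly_connected E W}"

lemma finite_sc_sets: "finite sc_sets"
  using finite_V by auto

text \<open>A strongly connected set that contains \<open>v\<close> and lies inside
  \<open>phi\<close> is connected there in both directions with \<open>v\<close>, hence lies in its
  component.\<close>

lemma subset_psi_iff:
  assumes "strongly_connected E S" "v \<in> S"
  shows "S \<subseteq> psi E a v \<longleftrightarrow> S \<subseteq> phi E a v"
proof
  assume S: "S \<subseteq> phi E a v"
  then have "(E \<inter> S \<times> S)\<^sup>* \<subseteq> (E \<inter> phi E a v \<times> phi E a v)\<^sup>*"
    by (intro rtrancl_mono) auto
  then show "S \<subseteq> psi E a v"
    using assms S unfolding strongly_connected_def psi_def Let_def by auto
qed (auto simp: psi_def Let_def)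

text \<open>The component is cut out by reachability in all of \<open>phi\<close>; the point is that
  the paths concerned stay inside the component.\<close>

lemma strongly_connected_psi: "strongly_connected E (psi E a v)"
proof -
  define R where "R = E \<inter> phi E a v \<times> phi E a v"
  define P where "P = psi E a v"
  have P: "P = {u \<in> phi E a v. (v, u) \<in> R\<^sup>* \<and> (u, v) \<in> R\<^sup>*}"
    unfolding P_def R_def psi_def Let_def by simp
  have vP: "v \<in> P"
    using root_in_phi unfolding P by simp
  have from_v: "(v, u) \<in> (E \<inter> P \<times> P)\<^sup>*" if "(v, u) \<in> R\<^sup>*" "(u, v) \<in> R\<^sup>*" for u
    using that
  proof (induction rule: rtrancl_induct)
    case (step y z)
    then have "(y, v) \<in> R\<^sup>*"
      by (auto intro: converse_rtrancl_into_rtrancl)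
    moreover from this step have "y \<in> P" "z \<in> P"
      unfolding P R_def by (auto intro: rtrancl_into_rtrancl)
    ultimately show ?case
      using step unfolding R_def by (auto intro: rtrancl_into_rtrancl)
  qed simp
  have to_v: "(u, v) \<in> (E \<inter> P \<times> P)\<^sup>*" if "(u, v) \<in> R\<^sup>*" "(v, u) \<in> R\<^sup>*" for u
    using that
  proof (induction rule: converse_rtrancl_induct)
    case (step y z)
    then have "(v, z) \<in> R\<^sup>*"
      by (auto intro: rtrancl_into_rtrancl)
    moreover from this step have "y \<in> P" "z \<in> P"
      unfolding P R_def by (auto intro: converse_rtrancl_into_rtrancl)
    ultimately show ?case
      using step unfolding R_def by (auto intro: converse_rtrancl_into_rtrancl)
  qed simp
  show ?thesis
    unfolding strongly_connected_def P_def[symmetric]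
    using vP from_v to_v unfolding P by (blast intro: rtrancl_trans)
qed

lemma psi_subset:
  assumes "v \<in> V"
  shows "psi E a v \<subseteq> V"
proof -
  obtain C R where "explores a (explore_init E v) C R (insert v (fst ` C))" "C \<subseteq> E \<inter> a"
    using obtain_exploration by metis
  then have "phi E a v \<subseteq> V"
    using phi_eq assms E_subset by fastforce
  then show ?thesis
    unfolding psi_def Let_def by blast
qed

text \<open>The trees counted by \<open>bij_betw_trees_forests\<close> are sorted by their value of
  \<open>psi\<close>. The right-hand side no longer mentions \<open>v\<close>.\<close>

lemma sum_m_at:
  assumes "strongly_connected E S" "v \<in> S" "S \<subseteq> V"
  shows "(\<Sum>W\<in>{W \<in> sc_sets. S \<subseteq> W}. m_at V E W v) = card {b. is_forest V E S b}"
proof -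
  have "card {b. is_forest V E S b} = card {a. is_sptree V E a v \<and> S \<subseteq> phi E a v}"
    using bij_betw_same_card[OF bij_betw_trees_forests[OF assms]] by simp
  also have "{a. is_sptree V E a v \<and> S \<subseteq> phi E a v} =
      (\<Union>W\<in>{W \<in> sc_sets. S \<subseteq> W}. {a. is_sptree V E a v \<and> psi E a v = W})"
    using subset_psi_iff[OF assms(1,2)] psi_subset strongly_connected_psi assms(2,3) by auto
  also have "card \<dots> = (\<Sum>W\<in>{W \<in> sc_sets. S \<subseteq> W}. m_at V E W v)"
    unfolding m_at_def using finite_V finite_rooted_trees
    by (intro card_UN_disjoint) auto
  finally show ?thesis by simp
qed

text \<open>Inversion of \<open>sum_m_at\<close> from the top: its total does not depend on the base
  vertex, and by induction neither do the terms for proper supersets of \<open>W\<close>, so the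
  remaining term does not either.\<close>

lemma m_at_independent:
  assumes "strongly_connected E W" "v \<in> W" "w \<in> W" "W \<subseteq> V"
  shows "m_at V E W v = m_at V E W w"
  using assms
proof (induction "card (V - W)" arbitrary: W rule: less_induct)
  case less
  define Z where "Z = {W' \<in> sc_sets. W \<subset> W'}"
  have fin: "finite Z" unfolding Z_def using finite_V by auto
  have "{W' \<in> sc_sets. W \<subseteq> W'} = insert W Z" "W \<notin> Z"
    using less.prems unfolding Z_def by auto
  then have split: "m_at V E W u + (\<Sum>W'\<in>Z. m_at V E W' u) = card {b. is_forest V E W b}"
    if "u \<in> W" for u
    using sum_m_at[of W u] less.prems that fin by simp
  have "(\<Sum>W'\<in>Z. m_at V E W' v) = (\<Sum>W'\<in>Z. m_at V E W' w)"
  proof (rule sum.cong[OF refl])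
    fix W' assume W': "W' \<in> Z"
    then have "card (V - W') < card (V - W)"
      using finite_V less.prems unfolding Z_def by (intro psubset_card_mono) auto
    then show "m_at V E W' v = m_at V E W' w"
      using less.hyps[of W'] W' less.prems unfolding Z_def by blast
  qed
  then show ?case
    using split[of v] split[of w] less.prems by simp
qed

lemma m_eq_m_at:
  assumes "strongly_connected E W" "v \<in> W" "W \<subseteq> V"
  shows "m V E W = m_at V E W v"
  unfolding m_def using assms by (intro m_at_independent) (auto intro: someI)

lemma sum_m:
  assumes "strongly_connected E S" "S \<subseteq> V"
  shows "(\<Sum>W\<in>{W \<in> sc_sets. S \<subseteq> W}. m V E W) = card {b. is_forest V E S b}"
proof -
  obtain v where v: "v \<in> S"
    using assms unfolding strongly_connected_def by blast
  have "(\<Sum>W\<in>{W \<in> sc_sets. S \<subseteq> W}. m V E W) = (\<Sum>W\<in>{W \<in> sc_sets. S \<subseteq> W}. m_at V E W v)"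
    using v by (intro sum.cong refl m_eq_m_at) auto
  then show ?thesis
    using sum_m_at[OF assms(1) v assms(2)] by simp
qed

text \<open>Over \<open>S = V\<close> the identity \<open>sum_m\<close> has a single term, and the
  only forest rooted in all of \<open>V\<close> is empty.\<close>

lemma m_V:
  assumes "strongly_connected E V"
  shows "m V E V = 1"
proof -
  have "{W \<in> sc_sets. V \<subseteq> W} = {V}"
    using assms by auto
  moreover have "{b. is_forest V E V b} = {{}}"
    unfolding forest_iff_acyclic by (auto simp: acyclic_def)
  ultimately show ?thesis
    using sum_m[OF assms] by simp
qed

end

section \<open>Power sums\<close>

text \<open>Summing a polynomial over a multiset gives a combination of its power sums, with
  \<open>k = 0\<close> serving the constant term. Characteristic zero allows a multiplicity to be
  read off such a sum.\<close>

lemma power_sums_determine_multiset: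
  fixes A B :: "'a::field_char_0 multiset"
  assumes pow: "\<And>k. (\<Sum>a\<in>#A. a ^ k) = (\<Sum>b\<in>#B. b ^ k)"
  shows "A = B"
proof (rule multiset_eqI)
  fix z
  have poly_sum: "(\<Sum>a\<in>#M. poly p a) = (\<Sum>i\<le>degree p. coeff p i * (\<Sum>a\<in>#M. a ^ i))"
    for p :: "'a poly" and M
    unfolding poly_altdef by (induction M) (simp_all add: sum.distrib algebra_simps)
  \<comment> \<open>The polynomial \<open>p\<close> vanishes at every occurring value other than
    \<open>z\<close>, so its sum isolates the multiplicity of \<open>z\<close>.\<close>
  define Z where "Z = (set_mset A \<union> set_mset B) - {z}"
  define p where "p = (\<Prod>c\<in>Z. [:-c, 1:])"
  have fin: "finite Z" unfolding Z_def by simp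
  have p0: "poly p a = 0" if "a \<in> Z" for a
    using fin that unfolding p_def poly_prod by (intro prod_zero) auto
  have pz: "poly p z \<noteq> 0"
    using fin unfolding p_def poly_prod by (auto simp: Z_def)
  have count: "(\<Sum>a\<in>#M. poly p a) = of_nat (count M z) * poly p z"
    if "set_mset M \<subseteq> insert z Z" for M
    using that by (induction M) (auto simp: p0 algebra_simps)
  have "(\<Sum>a\<in>#A. poly p a) = (\<Sum>b\<in>#B. poly p b)"
    unfolding poly_sum pow ..
  moreover have "set_mset A \<subseteq> insert z Z" "set_mset B \<subseteq> insert z Z"
    unfolding Z_def by auto
  ultimately show "count A z = count B z"
    using count pz by simp
qed

section \<open>Matrices indexed by finite sets\<close>

text \<open>Matrices are indexed by initial segments of the naturals. An arbitrary enumeration is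
  enough, since only determinants, characteristic polynomials and traces are taken.\<close>

definition enum_of :: "'i set \<Rightarrow> nat \<Rightarrow> 'i" where
  "enum_of I = (SOME f. bij_betw f {0..<card I} I)"

definition mat_of :: "'i set \<Rightarrow> ('i \<Rightarrow> 'i \<Rightarrow> 'a) \<Rightarrow> 'a mat" where
  "mat_of I A = mat (card I) (card I) (\<lambda>(i, j). A (enum_of I i) (enum_of I j))"

lemma bij_betw_enum_of: "finite I \<Longrightarrow> bij_betw (enum_of I) {0..<card I} I"
  unfolding enum_of_def by (rule someI_ex[OF ex_bij_betw_nat_finite])

lemma mat_of_carrier [simp]: "mat_of I A \<in> carrier_mat (card I) (card I)"
  unfolding mat_of_def by simp

lemma enum_of_in: "finite I \<Longrightarrow> i < card I \<Longrightarrow> enum_of I i \<in> I"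
  using bij_betw_enum_of[of I] by (auto simp: bij_betw_def)

lemma enum_of_eq_iff: "finite I \<Longrightarrow> i < card I \<Longrightarrow> j < card I \<Longrightarrow> enum_of I i = enum_of I j \<longleftrightarrow> i = j"
  using bij_betw_enum_of[of I] by (auto simp: bij_betw_def inj_on_def)

lemma sum_enum_of: "finite I \<Longrightarrow> (\<Sum>i = 0..<card I. f (enum_of I i)) = (\<Sum>u\<in>I. f u)"
  using sum.reindex_bij_betw[OF bij_betw_enum_of] .

lemma prod_enum_of: "finite I \<Longrightarrow> (\<Prod>i = 0..<card I. f (enum_of I i)) = (\<Prod>u\<in>I. f u)"
  using prod.reindex_bij_betw[OF bij_betw_enum_of] .

lemma mat_of_cong:
  assumes "finite I" "\<And>u w. u \<in> I \<Longrightarrow> w \<in> I \<Longrightarrow> A u w = B u w"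
  shows "mat_of I A = mat_of I B"
  unfolding mat_of_def using assms by (intro cong_mat) (auto simp: enum_of_in)

text \<open>Conjugation by the enumeration carries permutations of indices to permutations of
  \<open>I\<close> and preserves signs, so the enumeration disappears from the Leibniz
  formula.\<close>

lemma det_mat_of:
  fixes A :: "'i \<Rightarrow> 'i \<Rightarrow> 'a::comm_ring_1"
  assumes "finite I"
  shows "det (mat_of I A) = (\<Sum>\<sigma> | \<sigma> permutes I. of_int (sign \<sigma>) * (\<Prod>u\<in>I. A u (\<sigma> u)))"
proof -
  define N where "N = {0..<card I}"
  let ?f = "enum_of I" and ?g = "inv_into N (enum_of I)"
  have f: "bij_betw ?f N I"
    unfolding N_def by (rule bij_betw_enum_of[OF assms])
  have g: "bij_betw ?g I N"
    using f by (rule bij_betw_inv_into)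
  have inj: "inj_on ?f N" "inj_on ?g I"
    using f g by (auto simp: bij_betw_def)
  have fg: "?f (?g u) = u" if "u \<in> I" for u
    using f that by (simp add: bij_betw_inv_into_right)
  have gf: "?g (?f i) = i" if "i \<in> N" for i
    using f that by (simp add: bij_betw_inv_into_left)
  have "det (mat_of I A) = (\<Sum>p | p permutes N. signof p * (\<Prod>i\<in>N. mat_of I A $$ (i, p i)))"
    using det_def'[OF mat_of_carrier] unfolding N_def by auto
  also have "\<dots> = (\<Sum>\<sigma> | \<sigma> permutes I. of_int (sign \<sigma>) * (\<Prod>u\<in>I. A u (\<sigma> u)))"
  proof (rule sum.reindex_bij_witness[of _ "map_permutation I ?g" "map_permutation N ?f"])
    fix p assume "p \<in> {p. p permutes N}"
    then have p: "p permutes N" by simp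
    show "map_permutation I ?g (map_permutation N ?f p) = p"
      using map_permutation_compose_inv[OF f p] gf by simp
    show "map_permutation N ?f p \<in> {\<sigma>. \<sigma> permutes I}"
      using map_permutation_permutes[OF f p] by simp
    have "(\<Prod>i\<in>N. mat_of I A $$ (i, p i)) = (\<Prod>i\<in>N. A (?f i) (map_permutation N ?f p (?f i)))"
    proof (rule prod.cong[OF refl])
      fix i assume i: "i \<in> N"
      then have "p i \<in> N"
        using permutes_in_image[OF p] by simp
      then show "mat_of I A $$ (i, p i) = A (?f i) (map_permutation N ?f p (?f i))"
        using i inj(1) unfolding mat_of_def N_def by (simp add: map_permutation_apply)
    qed
    also have "\<dots> = (\<Prod>u\<in>I. A u (map_permutation N ?f p u))"
      unfolding N_def by (rule prod_enum_of[OF assms])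
    finally show "of_int (sign (map_permutation N ?f p)) * (\<Prod>u\<in>I. A u (map_permutation N ?f p u)) =
        signof p * (\<Prod>i\<in>N. mat_of I A $$ (i, p i))"
      using sign_map_permutation[OF inj(1) p] unfolding N_def by simp
  next
    fix \<sigma> assume "\<sigma> \<in> {\<sigma>. \<sigma> permutes I}"
    then have \<sigma>: "\<sigma> permutes I" by simp
    show "map_permutation N ?f (map_permutation I ?g \<sigma>) = \<sigma>"
      using map_permutation_compose_inv[OF g \<sigma>] fg by simp
    show "map_permutation I ?g \<sigma> \<in> {p. p permutes N}"
      using map_permutation_permutes[OF g \<sigma>] by simp
  qed
  finally show ?thesis .
qed

lemma det_mat_of_eq_0:
  fixes A :: "'i \<Rightarrow> 'i \<Rightarrow> 'a::idom"
  assumes "finite I" "z \<in> I" "y z \<noteq> 0"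
    and ker: "\<And>u. u \<in> I \<Longrightarrow> (\<Sum>w\<in>I. A u w * y w) = 0"
  shows "det (mat_of I A) = 0"
proof -
  define n where "n = card I"
  define v where "v = vec n (\<lambda>i. y (enum_of I i))"
  obtain i where i: "i < n" "enum_of I i = z"
    using bij_betw_enum_of[OF assms(1)] assms(2) unfolding n_def bij_betw_def
    by (metis atLeastLessThan_iff imageE)
  have "v \<noteq> 0\<^sub>v n"
  proof
    assume "v = 0\<^sub>v n"
    then have "v $ i = 0" using i by simp
    then show False using i assms(3) unfolding v_def by simp
  qed
  moreover have "mat_of I A *\<^sub>v v = 0\<^sub>v n"
  proof (rule eq_vecI)
    fix j assume "j < dim_vec (0\<^sub>v n)"
    then have j: "j < n" by simp
    have "(mat_of I A *\<^sub>v v) $ j = (\<Sum>k = 0..<n. A (enum_of I j) (enum_of I k) * y (enum_of I k))"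
      using j unfolding mat_of_def v_def n_def[symmetric] by (simp add: scalar_prod_def)
    also have "\<dots> = (\<Sum>w\<in>I. A (enum_of I j) w * y w)"
      unfolding n_def by (rule sum_enum_of[OF assms(1)])
    also have "\<dots> = 0"
      using ker enum_of_in assms(1) j unfolding n_def by blast
    finally show "(mat_of I A *\<^sub>v v) $ j = 0\<^sub>v n $ j"
      using j by simp
  qed (simp add: n_def mat_of_def)
  moreover have "v \<in> carrier_vec n"
    unfolding v_def by simp
  ultimately show ?thesis
    using det_0_iff_vec_prod_zero[OF mat_of_carrier[of I A]] unfolding n_def by blast
qed

lemma char_poly_mat_of:
  assumes "finite I"
  shows "char_poly (mat_of I A) =
    det (mat_of I (\<lambda>u w. (if u = w then [:0, 1:] else 0) - [:A u w:]))"
proof -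
  have "char_poly_matrix (mat_of I A) =
      mat_of I (\<lambda>u w. (if u = w then [:0, 1:] else 0) - [:A u w:])"
    using assms unfolding char_poly_matrix_def mat_of_def
    by (intro eq_matI) (auto simp: enum_of_eq_iff)
  then show ?thesis
    unfolding char_poly_def by simp
qed

section \<open>Matrix powers, traces and eigenvalues\<close>

fun entry_pow :: "'i set \<Rightarrow> ('i \<Rightarrow> 'i \<Rightarrow> 'a::comm_ring_1) \<Rightarrow> nat \<Rightarrow> 'i \<Rightarrow> 'i \<Rightarrow> 'a" where
  "entry_pow I A 0 u w = (if u = w then 1 else 0)"
| "entry_pow I A (Suc k) u w = (\<Sum>z\<in>I. A u z * entry_pow I A k z w)"

lemma pow_mat_Suc_left:
  assumes "A \<in> carrier_mat n n"
  shows "A ^\<^sub>m Suc k = A * A ^\<^sub>m k"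
proof (induction k)
  case 0
  then show ?case using assms by simp
next
  case (Suc k)
  have "A ^\<^sub>m Suc (Suc k) = (A * A ^\<^sub>m k) * A"
    using Suc by simp
  also have "\<dots> = A * (A ^\<^sub>m k * A)"
    using assms by (intro assoc_mult_mat) auto
  finally show ?case by simp
qed

lemma mat_of_pow:
  assumes "finite I"
  shows "mat_of I A ^\<^sub>m k = mat_of I (entry_pow I A k)"
proof (induction k)
  case 0
  show ?case
    using assms by (intro eq_matI) (auto simp: mat_of_def enum_of_eq_iff)
next
  case (Suc k)
  have "mat_of I A * mat_of I (entry_pow I A k) = mat_of I (entry_pow I A (Suc k))"
  proof (rule eq_matI)
    fix i j assume "i < dim_row (mat_of I (entry_pow I A (Suc k)))"
      "j < dim_col (mat_of I (entry_pow I A (Suc k)))"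
    then have ij: "i < card I" "j < card I"
      unfolding mat_of_def by auto
    then show "(mat_of I A * mat_of I (entry_pow I A k)) $$ (i, j) =
        mat_of I (entry_pow I A (Suc k)) $$ (i, j)"
      using sum_enum_of[OF assms, of "\<lambda>z. A (enum_of I i) z * entry_pow I A k z (enum_of I j)"]
      unfolding mat_of_def by (simp add: scalar_prod_def)
  qed (auto simp: mat_of_def)
  then show ?case
    unfolding pow_mat_Suc_left[OF mat_of_carrier] Suc .
qed

lemma trace_mult_commute:
  fixes A B :: "'a::comm_ring_1 mat"
  assumes "A \<in> carrier_mat n n" "B \<in> carrier_mat n n"
  shows "(\<Sum>i = 0..<n. (A * B) $$ (i, i)) = (\<Sum>i = 0..<n. (B * A) $$ (i, i))"
proof -
  have "(\<Sum>i = 0..<n. (A * B) $$ (i, i)) = (\<Sum>i = 0..<n. \<Sum>j = 0..<n. A $$ (i, j) * B $$ (j, i))"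
    using assms by (intro sum.cong) (auto simp: scalar_prod_def)
  also have "\<dots> = (\<Sum>j = 0..<n. \<Sum>i = 0..<n. B $$ (j, i) * A $$ (i, j))"
    by (subst sum.swap) (simp add: mult.commute)
  also have "\<dots> = (\<Sum>i = 0..<n. (B * A) $$ (i, i))"
    using assms by (intro sum.cong) (auto simp: scalar_prod_def)
  finally show ?thesis .
qed

lemma upper_triangular_pow:
  fixes B :: "'a::comm_ring_1 mat"
  assumes "B \<in> carrier_mat n n" "upper_triangular B"
  shows "upper_triangular (B ^\<^sub>m k) \<and> (\<forall>i<n. (B ^\<^sub>m k) $$ (i, i) = B $$ (i, i) ^ k)"
proof (induction k)
  case 0
  then show ?case using assms by auto
next
  case (Suc k)
  define C where "C = B ^\<^sub>m k"
  have C: "C \<in> carrier_mat n n" "\<And>i j. j < i \<Longrightarrow> i < n \<Longrightarrow> C $$ (i, j) = 0"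
    "\<And>i. i < n \<Longrightarrow> C $$ (i, i) = B $$ (i, i) ^ k"
    using Suc assms(1) unfolding C_def by auto
  have B: "\<And>i j. j < i \<Longrightarrow> i < n \<Longrightarrow> B $$ (i, j) = 0"
    using assms by auto
  have entry: "(C * B) $$ (i, j) = (\<Sum>l = 0..<n. C $$ (i, l) * B $$ (l, j))"
    if "i < n" "j < n" for i j
    using that C(1) assms(1) by (simp add: scalar_prod_def)
  have "(C * B) $$ (i, j) = 0" if "j < i" "i < n" for i j
  proof -
    have "C $$ (i, l) * B $$ (l, j) = 0" if "l < n" for l
      using C(2)[of l i] B[of j l] \<open>j < i\<close> \<open>i < n\<close> that by (cases "l < i") auto
    then show ?thesis
      using entry that by simp
  qed
  moreover have "(C * B) $$ (i, i) = B $$ (i, i) ^ Suc k" if "i < n" for i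
  proof -
    have "C $$ (i, l) * B $$ (l, i) = (if l = i then B $$ (i, i) ^ Suc k else 0)" if "l < n" for l
      using C(2)[of l i] C(3)[of i] B[of i l] \<open>i < n\<close> that
      by (cases l i rule: linorder_cases) (auto simp: mult.commute)
    then show ?thesis
      using entry that by simp
  qed
  ultimately show ?case
    using C(1) assms(1) unfolding C_def by auto
qed

text \<open>One triangular form serves both claims: its diagonal lists the roots of the
  characteristic polynomial with multiplicity, and cyclicity of the trace carries the traces of
  powers over to it.\<close>

lemma eigenvalues_mat_of:
  fixes A :: "'i \<Rightarrow> 'i \<Rightarrow> complex"
  assumes "finite I"
  shows "\<exists>es. char_poly (mat_of I A) = (\<Prod>e\<in>#es. [:-e, 1:])
    \<and> (\<forall>k. (\<Sum>u\<in>I. entry_pow I A k u u) = (\<Sum>e\<in>#es. e ^ k))"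
proof -
  define n where "n = card I"
  define M where "M = mat_of I A"
  have M: "M \<in> carrier_mat n n"
    unfolding M_def n_def by simp
  obtain as where as: "char_poly M = (\<Prod>a\<leftarrow>as. [:-a, 1:])"
    using char_poly_factorized[OF M] by blast
  obtain B where B: "B \<in> carrier_mat n n" "upper_triangular B" and "similar_mat M B"
    using schur_upper_triangular[OF M as] by blast
  then obtain P Q where wit: "similar_mat_wit M B P Q"
    unfolding similar_mat_def by blast
  note PQ = similar_mat_witD2[OF M wit]
  have "char_poly M = (\<Prod>a\<leftarrow>diag_mat B. [:-a, 1:])"
    using char_poly_similar[OF \<open>similar_mat M B\<close>] char_poly_upper_triangular[OF B] by simp
  then have char: "char_poly M = (\<Prod>e\<in>#mset (diag_mat B). [:-e, 1:])"
    by (simp flip: prod_mset_prod_list mset_map)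
  have "(\<Sum>u\<in>I. entry_pow I A k u u) = (\<Sum>e\<in>#mset (diag_mat B). e ^ k)" for k
  proof -
    have "(\<Sum>u\<in>I. entry_pow I A k u u) = (\<Sum>i = 0..<n. (M ^\<^sub>m k) $$ (i, i))"
      unfolding M_def mat_of_pow[OF assms] n_def
      by (subst sum_enum_of[OF assms, symmetric]) (simp add: mat_of_def)
    also have "M ^\<^sub>m k = P * (B ^\<^sub>m k * Q)"
      unfolding similar_mat_wit_pow_id[OF wit] using PQ B by (intro assoc_mult_mat) auto
    also have "(\<Sum>i = 0..<n. (P * (B ^\<^sub>m k * Q)) $$ (i, i)) = (\<Sum>i = 0..<n. ((B ^\<^sub>m k * Q) * P) $$ (i, i))"
      using PQ B by (intro trace_mult_commute) auto
    also have "(B ^\<^sub>m k * Q) * P = B ^\<^sub>m k * (Q * P)"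
      using PQ B by (intro assoc_mult_mat) auto
    also have "\<dots> = B ^\<^sub>m k"
      using PQ(2) B(1) by simp
    also have "(\<Sum>i = 0..<n. (B ^\<^sub>m k) $$ (i, i)) = (\<Sum>i = 0..<n. B $$ (i, i) ^ k)"
      using upper_triangular_pow[OF B, of k] by (intro sum.cong) auto
    also have "\<dots> = (\<Sum>e\<in>#mset (diag_mat B). e ^ k)"
      using B(1) unfolding diag_mat_def
      by (simp add: sum_mset_sum_list interv_sum_list_conv_sum_set_nat comp_def
          flip: mset_map)
    finally show ?thesis .
  qed
  then show ?thesis
    using char unfolding M_def by blast
qed

text \<open>The right-hand traces are those of a block-diagonal matrix with \<open>c J\<close>
  copies of each block. That matrix is never formed; its eigenvalues are the sum of the repeated
  eigenvalue multisets.\<close>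

lemma char_poly_eq_prod_char_polys:
  fixes A :: "'i \<Rightarrow> 'i \<Rightarrow> complex" and B :: "'j \<Rightarrow> 'j \<Rightarrow> complex"
  assumes "finite I" "finite X" "\<And>J. J \<in> X \<Longrightarrow> finite J"
    and trace: "\<And>k. (\<Sum>u\<in>I. entry_pow I A k u u) =
      (\<Sum>J\<in>X. of_nat (c J) * (\<Sum>u\<in>J. entry_pow J B k u u))"
  shows "char_poly (mat_of I A) = (\<Prod>J\<in>X. char_poly (mat_of J B) ^ c J)"
proof -
  obtain es where es: "char_poly (mat_of I A) = (\<Prod>e\<in>#es. [:-e, 1:])"
    "\<And>k. (\<Sum>u\<in>I. entry_pow I A k u u) = (\<Sum>e\<in>#es. e ^ k)"
    using eigenvalues_mat_of[OF assms(1)] by blast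
  have "\<forall>J\<in>X. \<exists>es. char_poly (mat_of J B) = (\<Prod>e\<in>#es. [:-e, 1:])
    \<and> (\<forall>k. (\<Sum>u\<in>J. entry_pow J B k u u) = (\<Sum>e\<in>#es. e ^ k))"
    using eigenvalues_mat_of assms(3) by blast
  then obtain fs where fs: "\<And>J. J \<in> X \<Longrightarrow> char_poly (mat_of J B) = (\<Prod>e\<in>#fs J. [:-e, 1:])"
    "\<And>J k. J \<in> X \<Longrightarrow> (\<Sum>u\<in>J. entry_pow J B k u u) = (\<Sum>e\<in>#fs J. e ^ k)"
    by metis
  have sum_rep: "(\<Sum>e\<in>#repeat_mset r M. h e) = of_nat r * (\<Sum>e\<in>#M. h e)"
    for r and M :: "complex multiset" and h :: "complex \<Rightarrow> complex"
    by (induction r) (simp_all add: distrib_right sum_mset.distrib)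
  have prod_rep: "(\<Prod>e\<in>#repeat_mset r M. h e) = (\<Prod>e\<in>#M. h e) ^ r"
    for r and M :: "complex multiset" and h :: "complex \<Rightarrow> complex poly"
    by (induction r) simp_all
  have sum_sum: "(\<Sum>e\<in>#(\<Sum>J\<in>X. repeat_mset (c J) (fs J)). h e) =
      (\<Sum>J\<in>X. of_nat (c J) * (\<Sum>e\<in>#fs J. h e))" for h :: "complex \<Rightarrow> complex"
    using assms(2) by (induction X rule: finite_induct) (simp_all add: sum_rep)
  have prod_sum: "(\<Prod>e\<in>#(\<Sum>J\<in>X. repeat_mset (c J) (fs J)). h e) =
      (\<Prod>J\<in>X. (\<Prod>e\<in>#fs J. h e) ^ c J)" for h :: "complex \<Rightarrow> complex poly"
    using assms(2) by (induction X rule: finite_induct) (simp_all add: prod_rep)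
  have "es = (\<Sum>J\<in>X. repeat_mset (c J) (fs J))"
  proof (rule power_sums_determine_multiset)
    fix k
    show "(\<Sum>e\<in>#es. e ^ k) = (\<Sum>e\<in>#(\<Sum>J\<in>X. repeat_mset (c J) (fs J)). e ^ k)"
      unfolding sum_sum es(2)[symmetric] trace by (intro sum.cong refl) (simp add: fs(2))
  qed
  then show ?thesis
    unfolding es(1) by (simp add: prod_sum fs(1))
qed

section \<open>The matrix-tree theorem\<close>

text \<open>This is minus the Laplacian: its characteristic polynomial is the determinant of \<open>X + L\<close>.\<close>

definition generator :: "('v \<times> 'v) set \<Rightarrow> ('v \<times> 'v \<Rightarrow> 'a::comm_ring_1) \<Rightarrow> 'v \<Rightarrow> 'v \<Rightarrow> 'a" where
  "generator E x u w =
    (if (u, w) \<in> E then x (u, w) else 0) - (if u = w then \<Sum>t | (u, t) \<in> E. x (u, t) else 0)"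

text \<open>The value \<open>None\<close> makes a vertex a root.\<close>

definition graph_of :: "'v set \<Rightarrow> ('v \<Rightarrow> 'v option) \<Rightarrow> ('v \<times> 'v) set" where
  "graph_of I p = {(u, t). u \<in> I \<and> p u = Some t}"

lemma graph_of_single_valued: "single_valued (graph_of I p)"
  unfolding graph_of_def single_valued_def by auto

text \<open>Without cycles only the identity permutation survives in the Leibniz formula; with a
  cycle there is a kernel vector. A value \<open>None\<close> and a target outside \<open>I\<close>
  both leave a row of the identity matrix, so both act as the end of a path.\<close>

lemma det_functional_graph:
  fixes p :: "'v \<Rightarrow> 'v option"
  assumes "finite I"
  shows "det (mat_of I (\<lambda>u w. (if u = w then 1 else 0) - (if p u = Some w then 1 else 0))) =
    (if acyclic (graph_of I p) then 1 else (0 :: 'a::idom))"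
proof (cases "acyclic (graph_of I p)")
  case True
  let ?N = "\<lambda>u w. (if u = w then 1 else 0) - (if p u = Some w then 1 else (0 :: 'a))"
  have "(\<Prod>u\<in>I. ?N u (\<sigma> u)) = (if \<sigma> = id then 1 else 0)" if \<sigma>: "\<sigma> permutes I" for \<sigma>
  proof (cases "\<sigma> = id")
    case True
    have "p u \<noteq> Some u" if "u \<in> I" for u
      using \<open>acyclic (graph_of I p)\<close> that unfolding acyclic_def graph_of_def by blast
    then show ?thesis
      unfolding True by simp
  next
    case False
    have "\<exists>u\<in>I. ?N u (\<sigma> u) = 0"
    proof (rule ccontr)
      assume "\<not> (\<exists>u\<in>I. ?N u (\<sigma> u) = 0)"
      then have moved: "p u = Some (\<sigma> u)" if "u \<in> I" "\<sigma> u \<noteq> u" for u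
        using that by (force split: if_splits)
      \<comment> \<open>Each point moved by \<open>\<sigma>\<close> has an edge to
        \<open>\<sigma> u\<close>, which is moved as well. A finite acyclic graph admits no such
        nonempty set.\<close>
      define D where "D = {u. \<sigma> u \<noteq> u}"
      have DI: "D \<subseteq> I"
        using \<sigma> unfolding D_def permutes_def by blast
      have step: "\<exists>w\<in>D. (u, w) \<in> graph_of I p" if "u \<in> D" for u
      proof
        show "(u, \<sigma> u) \<in> graph_of I p"
          using moved that DI unfolding graph_of_def D_def by auto
        show "\<sigma> u \<in> D"
          using that permutes_inj[OF \<sigma>] unfolding D_def by (auto dest: injD)
      qed
      have "finite (graph_of I p)"
        by (rule finite_subset[of _ "(\<lambda>u. (u, the (p u))) ` I"])
          (use assms in \<open>auto simp: graph_of_def image_iff\<close>)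
      then have "wf ((graph_of I p)\<inverse>)"
        using \<open>acyclic (graph_of I p)\<close> by (rule finite_acyclic_wf_converse)
      moreover obtain u where "u \<in> D"
        using False unfolding D_def by (auto simp: fun_eq_iff)
      ultimately obtain z where "z \<in> D" "\<And>y. (z, y) \<in> graph_of I p \<Longrightarrow> y \<notin> D"
        by (rule wfE_min) auto
      then show False
        using step by blast
    qed
    then show ?thesis
      using False assms by (auto intro: prod_zero)
  qed
  then have "det (mat_of I ?N) = (\<Sum>\<sigma> | \<sigma> permutes I. of_int (sign \<sigma>) * (if \<sigma> = id then 1 else 0))"
    unfolding det_mat_of[OF assms] by (intro sum.cong) auto
  also have "\<dots> = (\<Sum>\<sigma> | \<sigma> permutes I. if \<sigma> = id then 1 else 0)"
    by (intro sum.cong) auto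
  also have "\<dots> = 1"
    using finite_permutations[OF assms] permutes_id by (simp add: sum.delta)
  finally show ?thesis
    using True by simp
next
  case False
  define T where "T = graph_of I p"
  \<comment> \<open>The indicator of the vertices leading into a cycle lies in the kernel.\<close>
  define Y where "Y = {u. \<exists>z. (u, z) \<in> T\<^sup>* \<and> (z, z) \<in> T\<^sup>+}"
  define y :: "'v \<Rightarrow> 'a" where "y u = (if u \<in> Y then 1 else 0)" for u
  obtain z where z: "(z, z) \<in> T\<^sup>+"
    using False unfolding acyclic_def T_def by blast
  have Y_dom: "u \<in> Domain T" if "u \<in> Y" for u
    using that unfolding Y_def by (auto elim: converse_rtranclE dest: tranclD)
  have Y_step: "u \<in> Y \<longleftrightarrow> w \<in> Y" if uw: "(u, w) \<in> T" for u w
  proof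
    assume "u \<in> Y"
    then obtain c where c: "(u, c) \<in> T\<^sup>*" "(c, c) \<in> T\<^sup>+"
      unfolding Y_def by blast
    then have "(u, c) \<in> T\<^sup>+"
      by simp
    then obtain w' where "(u, w') \<in> T" "(w', c) \<in> T\<^sup>*"
      by (meson tranclD)
    moreover from this have "w' = w"
      using uw graph_of_single_valued unfolding T_def by (metis single_valuedD)
    ultimately show "w \<in> Y"
      using c unfolding Y_def by blast
  next
    assume "w \<in> Y"
    then show "u \<in> Y"
      using uw unfolding Y_def by (blast intro: converse_rtrancl_into_rtrancl)
  qed
  have "z \<in> Y"
    using z unfolding Y_def by blast
  then have zI: "z \<in> I" "y z \<noteq> 0"
    using Y_dom[of z] unfolding T_def graph_of_def y_def by auto
  have "det (mat_of I (\<lambda>u w. (if u = w then 1 else 0) - (if p u = Some w then 1 else 0))) = (0 :: 'a)"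
  proof (rule det_mat_of_eq_0[where y = y, OF assms zI])
    fix u assume u: "u \<in> I"
    have "(\<Sum>w\<in>I. ((if u = w then 1 else 0) - (if p u = Some w then 1 else 0)) * y w) =
        (\<Sum>w\<in>I. if u = w then y w else 0) - (\<Sum>w\<in>I. if p u = Some w then y w else 0)"
      unfolding sum_subtractf[symmetric] by (intro sum.cong) (auto simp: algebra_simps)
    also have "(\<Sum>w\<in>I. if u = w then y w else 0) = y u"
      using u assms by simp
    also have "(\<Sum>w\<in>I. if p u = Some w then y w else 0) = y u"
    proof (cases "p u")
      case None
      then have "u \<notin> Domain T"
        unfolding T_def graph_of_def by auto
      then show ?thesis
        using Y_dom None unfolding y_def by auto
    next
      case (Some w)
      then have uw: "(u, w) \<in> T"
        using u unfolding T_def graph_of_def by auto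
      have "(\<Sum>w\<in>I. if p u = Some w then y w else 0) = (if w \<in> I then y w else 0)"
        using Some assms by simp
      also have "\<dots> = y w"
        using Y_dom[of w] unfolding y_def T_def graph_of_def by auto
      also have "\<dots> = y u"
        using Y_step[OF uw] unfolding y_def by simp
      finally show ?thesis .
    qed
    finally show "(\<Sum>w\<in>I. ((if u = w then 1 else 0) - (if p u = Some w then 1 else 0)) * y w) = 0"
      by simp
  qed
  then show ?thesis
    using False by simp
qed

lemma sum_const_poly: "(\<Sum>i\<in>A. [:f i:]) = [:\<Sum>i\<in>A. f i:]"
  by (induction A rule: infinite_finite_induct) simp_all

lemma prod_const_poly: "(\<Prod>i\<in>A. [:f i:]) = [:\<Prod>i\<in>A. f i :: 'a::comm_ring_1:]"
  by (induction A rule: infinite_finite_induct) (simp_all add: one_pCons)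

context finite_digraph
begin

text \<open>Row \<open>u\<close> of the matrix is a sum over choices: \<open>X\<close> times a unit
  row, or the weight of an edge \<open>(u, t)\<close> times a difference of unit rows. Expanding the
  determinant multilinearly gives one term per choice function, and
  \<open>det_functional_graph\<close> keeps the acyclic ones. Vertices outside \<open>I\<close>
  become roots because paths end there.\<close>

lemma char_poly_generator:
  fixes x :: "'v \<times> 'v \<Rightarrow> 'a::idom"
  assumes I: "I \<subseteq> V"
  shows "char_poly (mat_of I (generator E x)) =
    (\<Sum>U\<in>Pow I. monom (Psi V E x (U \<union> (V - I))) (card U))"
proof -
  \<comment> \<open>The choice \<open>None\<close> stands for the factor \<open>X\<close>, so the
    exponent of \<open>X\<close> counts the roots inside \<open>I\<close>; \<open>Some t\<close>
    stands for a target \<open>t\<close>, with coefficient zero if there is no such edge.\<close>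
  define K where "K = insert None (Some ` V)"
  define c where "c = (\<lambda>u t. case t of None \<Rightarrow> [:0, 1:]
    | Some t \<Rightarrow> [:if (u, t) \<in> E then x (u, t) else 0:])"
  define N :: "'v option \<Rightarrow> 'v \<Rightarrow> 'v \<Rightarrow> 'a poly" where "N = (\<lambda>t u w. (if u = w then 1 else 0) - (if t = Some w then 1 else (0 :: 'a poly)))"
  have finI: "finite I"
    using I finite_V finite_subset by blast
  have sum_out: "(\<Sum>t\<in>V. if (u, t) \<in> E then x (u, t) else 0) = (\<Sum>t | (u, t) \<in> E. x (u, t))" for u
  proof -
    have "(\<Sum>t\<in>V. if (u, t) \<in> E then x (u, t) else 0) = (\<Sum>t\<in>{t \<in> V. (u, t) \<in> E}. x (u, t))"
      using finite_V by (rule sum.inter_filter[symmetric])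
    also have "{t \<in> V. (u, t) \<in> E} = {t. (u, t) \<in> E}"
      using E_subset by auto
    finally show ?thesis .
  qed
  have entry: "(if u = w then [:0, 1:] else 0) - [:generator E x u w:] = (\<Sum>t\<in>K. c u t * N t u w)"
    if "u \<in> I" "w \<in> I" for u w
  proof -
    let ?a = "\<lambda>t. if (u, t) \<in> E then x (u, t) else 0"
    have "(\<Sum>t\<in>K. c u t * N t u w) = c u None * N None u w + (\<Sum>t\<in>V. c u (Some t) * N (Some t) u w)"
      using finite_V unfolding K_def by (simp add: sum.reindex)
    also have "(\<Sum>t\<in>V. c u (Some t) * N (Some t) u w) =
        (\<Sum>t\<in>V. if u = w then [:?a t:] else 0) - (\<Sum>t\<in>V. if t = w then [:?a t:] else 0)"
      unfolding sum_subtractf[symmetric] c_def N_def by (intro sum.cong) (auto simp: algebra_simps)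
    also have "(\<Sum>t\<in>V. if t = w then [:?a t:] else 0) = [:?a w:]"
      using that I finite_V by auto
    also have "(\<Sum>t\<in>V. if u = w then [:?a t:] else 0) = (if u = w then [:\<Sum>t | (u, t) \<in> E. x (u, t):] else 0)"
      unfolding sum_out[symmetric] by (cases "u = w") (simp_all add: sum_const_poly)
    also have "c u None * N None u w = (if u = w then [:0, 1:] else 0)"
      unfolding c_def N_def by simp
    finally have "(\<Sum>t\<in>K. c u t * N t u w) = (if u = w then [:0, 1:] else 0) +
        ((if u = w then [:\<Sum>t | (u, t) \<in> E. x (u, t):] else 0) - [:?a w:])" .
    moreover have "[:generator E x u w:] =
        [:?a w:] - (if u = w then [:\<Sum>t | (u, t) \<in> E. x (u, t):] else 0)"
      unfolding generator_def by (cases "u = w") simp_all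
    ultimately show ?thesis
      by simp
  qed
  have "char_poly (mat_of I (generator E x)) = det (mat_of I (\<lambda>u w. \<Sum>t\<in>K. c u t * N t u w))"
    unfolding char_poly_mat_of[OF finI]
    by (rule arg_cong[of _ _ det], rule mat_of_cong[OF finI]) (rule entry)
  also have "\<dots> = (\<Sum>\<sigma> | \<sigma> permutes I. of_int (sign \<sigma>) *
      (\<Sum>p\<in>PiE I (\<lambda>_. K). \<Prod>u\<in>I. c u (p u) * N (p u) u (\<sigma> u)))"
    unfolding det_mat_of[OF finI]
    by (intro sum.cong arg_cong2[of _ _ _ _ "(*)"] refl prod_sum_PiE) (auto simp: finI finite_V K_def)
  also have "\<dots> = (\<Sum>p\<in>PiE I (\<lambda>_. K). (\<Prod>u\<in>I. c u (p u)) *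
      det (mat_of I (\<lambda>u w. N (p u) u w)))"
    unfolding det_mat_of[OF finI] sum_distrib_left prod.distrib
    by (subst sum.swap) (simp add: algebra_simps)
  also have "\<dots> = (\<Sum>p\<in>PiE I (\<lambda>_. K). (\<Prod>u\<in>I. c u (p u)) * (if acyclic (graph_of I p) then 1 else 0))"
    unfolding N_def det_functional_graph[OF finI] ..
  also have "\<dots> = (\<Sum>p\<in>{p \<in> PiE I (\<lambda>_. K). acyclic (graph_of I p) \<and> graph_of I p \<subseteq> E}. \<Prod>u\<in>I. c u (p u))"
  proof (rule sum.mono_neutral_cong_right)
    show "finite (PiE I (\<lambda>_. K))"
      using finI finite_V unfolding K_def by (intro finite_PiE) auto
    show "\<forall>p\<in>PiE I (\<lambda>_. K) - {p \<in> PiE I (\<lambda>_. K). acyclic (graph_of I p) \<and> graph_of I p \<subseteq> E}.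
       (\<Prod>u\<in>I. c u (p u)) * (if acyclic (graph_of I p) then 1 else 0) = 0"
    proof
      fix p assume p: "p \<in> PiE I (\<lambda>_. K) - {p \<in> PiE I (\<lambda>_. K). acyclic (graph_of I p) \<and> graph_of I p \<subseteq> E}"
      show "(\<Prod>u\<in>I. c u (p u)) * (if acyclic (graph_of I p) then 1 else 0) = 0"
      proof (cases "acyclic (graph_of I p)")
        case True
        then obtain u t where "u \<in> I" "p u = Some t" "(u, t) \<notin> E"
          using p unfolding graph_of_def by auto
        then have "u \<in> I" "c u (p u) = 0"
          unfolding c_def by auto
        then have "(\<Prod>u\<in>I. c u (p u)) = 0"
          using finI by (auto intro: prod_zero)
        then show ?thesis by simp
      qed simp
    qed
  qed auto
  also have "\<dots> = (\<Sum>(U, T)\<in>(SIGMA U:Pow I. {T. is_forest V E (U \<union> (V - I)) T}). monom (weight x T) (card U))"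
  proof (rule sum.reindex_bij_witness[of _
      "\<lambda>(U, T). \<lambda>u\<in>I. if u \<in> U then None else Some (THE t. (u, t) \<in> T)"
      "\<lambda>p. ({u \<in> I. p u = None}, graph_of I p)"])
    fix p assume "p \<in> {p \<in> PiE I (\<lambda>_. K). acyclic (graph_of I p) \<and> graph_of I p \<subseteq> E}"
    then have p: "p \<in> PiE I (\<lambda>_. K)" "acyclic (graph_of I p)" "graph_of I p \<subseteq> E" by auto
    let ?U = "{u \<in> I. p u = None}"
    show "(case (?U, graph_of I p) of (U, T) \<Rightarrow> \<lambda>u\<in>I. if u \<in> U then None else Some (THE t. (u, t) \<in> T)) = p"
      unfolding prod.case
    proof
      fix u
      show "(\<lambda>u\<in>I. if u \<in> ?U then None else Some (THE t. (u, t) \<in> graph_of I p)) u = p u"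
      proof (cases "u \<in> I")
        case False
        then show ?thesis using p(1) by (auto simp: PiE_def extensional_def)
      next
        case True
        then show ?thesis
          by (cases "p u") (auto simp: graph_of_def)
      qed
    qed
    have "Domain (graph_of I p) = V - (?U \<union> (V - I))"
      using I unfolding graph_of_def by auto
    then show "(?U, graph_of I p) \<in> (SIGMA U:Pow I. {T. is_forest V E (U \<union> (V - I)) T})"
      using p(2,3) graph_of_single_valued[of I p] unfolding forest_iff_acyclic by auto
    have "(\<Prod>u\<in>I. c u (p u)) = (\<Prod>u\<in>?U. c u (p u)) * (\<Prod>u\<in>I - ?U. c u (p u))"
      using finI by (subst prod.subset_diff[of ?U I]) (auto simp: mult.commute)
    also have "(\<Prod>u\<in>?U. c u (p u)) = [:0, 1:] ^ card ?U"
      by (simp add: c_def)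
    also have "(\<Prod>u\<in>I - ?U. c u (p u)) = (\<Prod>u\<in>I - ?U. [:x (u, the (p u)):])"
      using p(3) by (intro prod.cong) (auto simp: c_def graph_of_def)
    also have "\<dots> = (\<Prod>e\<in>graph_of I p. [:x e:])"
      by (rule prod.reindex_bij_witness[of _ fst "\<lambda>u. (u, the (p u))"]) (auto simp: graph_of_def)
    also have "\<dots> = [:weight x (graph_of I p):]"
      unfolding weight_def by (rule prod_const_poly)
    finally show "(case (?U, graph_of I p) of (U, T) \<Rightarrow> monom (weight x T) (card U)) = (\<Prod>u\<in>I. c u (p u))"
      by (simp add: monom_altdef mult.commute)
  next
    fix b assume "b \<in> (SIGMA U:Pow I. {T. is_forest V E (U \<union> (V - I)) T})"
    then obtain U T where b: "b = (U, T)" "U \<subseteq> I" and "is_forest V E (U \<union> (V - I)) T" by auto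
    then have T: "T \<subseteq> E" "single_valued T" "Domain T = I - U" "acyclic T"
      unfolding forest_iff_acyclic using I by auto
    let ?p = "\<lambda>u\<in>I. if u \<in> U then None else Some (THE t. (u, t) \<in> T)"
    have the: "(THE t. (u, t) \<in> T) = t" if "(u, t) \<in> T" for u t
      using that T(2) by (auto dest: single_valuedD)
    have U: "{u \<in> I. ?p u = None} = U"
      using b(2) by auto
    have G: "graph_of I ?p = T"
    proof (intro equalityI subsetI)
      fix e assume "e \<in> graph_of I ?p"
      then obtain u where u: "e = (u, THE t. (u, t) \<in> T)" "u \<in> I - U"
        unfolding graph_of_def by (auto split: if_splits)
      then obtain t where "(u, t) \<in> T"
        using T(3) by auto
      then show "e \<in> T"
        using u the by simp
    next
      fix e assume e: "e \<in> T"
      obtain u t where ut: "e = (u, t)" by fastforce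
      then have "u \<in> I - U"
        using T(3) e by auto
      then show "e \<in> graph_of I ?p"
        using the ut e unfolding graph_of_def by auto
    qed
    show "({u \<in> I. (case b of (U, T) \<Rightarrow> \<lambda>u\<in>I. if u \<in> U then None else Some (THE t. (u, t) \<in> T)) u = None},
        graph_of I (case b of (U, T) \<Rightarrow> \<lambda>u\<in>I. if u \<in> U then None else Some (THE t. (u, t) \<in> T))) = b"
      unfolding b(1) prod.case U G ..
    have "?p u \<in> K" if u: "u \<in> I" for u
    proof (cases "u \<in> U")
      case False
      then obtain t where "(u, t) \<in> T"
        using u T(3) by auto
      then show ?thesis
        using False u the T(1) E_subset unfolding K_def by auto
    qed (use u in \<open>simp add: K_def\<close>)
    then have "?p \<in> PiE I (\<lambda>_. K)"
      by (auto simp: PiE_iff)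
    then show "(case b of (U, T) \<Rightarrow> \<lambda>u\<in>I. if u \<in> U then None else Some (THE t. (u, t) \<in> T)) \<in>
        {p \<in> PiE I (\<lambda>_. K). acyclic (graph_of I p) \<and> graph_of I p \<subseteq> E}"
      unfolding b(1) prod.case using G T(1,4) by simp
  qed
  also have "\<dots> = (\<Sum>U\<in>Pow I. \<Sum>T | is_forest V E (U \<union> (V - I)) T. monom (weight x T) (card U))"
    using finI finite_forests by (subst sum.Sigma) auto
  also have "\<dots> = (\<Sum>U\<in>Pow I. monom (Psi V E x (U \<union> (V - I))) (card U))"
    unfolding Psi_def by (simp add: monom_hom.hom_sum)
  finally show ?thesis .
qed

lemma coeff_0_char_poly_generator:
  fixes x :: "'v \<times> 'v \<Rightarrow> 'a::idom"
  assumes "I \<subseteq> V"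
  shows "coeff (char_poly (mat_of I (generator E x))) 0 = Psi V E x (V - I)"
proof -
  have fin: "finite I"
    using assms finite_V finite_subset by blast
  have "coeff (char_poly (mat_of I (generator E x))) 0 =
      (\<Sum>U\<in>Pow I. if U = {} then Psi V E x (V - I) else 0)"
    unfolding char_poly_generator[OF assms] coeff_sum
    by (intro sum.cong) (use fin in \<open>auto simp: finite_subset\<close>)
  then show ?thesis
    using fin by simp
qed

text \<open>A path along out-edges must end at a root, so without roots there is no forest on a
  nonempty vertex set.\<close>

lemma Psi_empty: "V \<noteq> {} \<Longrightarrow> Psi V E x {} = 0"
  using forest_reaches_root[of "{}"] unfolding Psi_def by (intro sum.neutral) auto

lemma coeff_1_char_poly_generator:
  fixes x :: "'v \<times> 'v \<Rightarrow> 'a::idom"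
  shows "coeff (char_poly (mat_of V (generator E x))) 1 = F_G V E x"
proof -
  have "coeff (char_poly (mat_of V (generator E x))) 1 =
      (\<Sum>U\<in>Pow V. if card U = 1 then Psi V E x U else 0)"
    unfolding char_poly_generator[OF subset_refl] coeff_sum by (intro sum.cong) auto
  also have "\<dots> = (\<Sum>U\<in>{U \<in> Pow V. card U = 1}. Psi V E x U)"
    using finite_V by (intro sum.inter_filter[symmetric]) simp
  also have "\<dots> = (\<Sum>r\<in>V. Psi V E x {r})"
    by (rule sum.reindex_bij_witness[of _ "\<lambda>r. {r}" the_elem]) (auto simp: card_1_singleton_iff)
  also have "\<dots> = (\<Sum>r\<in>V. \<Sum>T | is_sptree V E T r. weight x T)"
    unfolding Psi_def is_sptree_iff_forest by (intro sum.cong) auto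
  also have "\<dots> = (\<Sum>T\<in>(\<Union>r\<in>V. {T. is_sptree V E T r}). weight x T)"
  proof (rule sum.UNION_disjoint[symmetric])
    show "\<forall>r\<in>V. finite {T. is_sptree V E T r}"
      using finite_rooted_trees by blast
    show "\<forall>r\<in>V. \<forall>s\<in>V. r \<noteq> s \<longrightarrow> {T. is_sptree V E T r} \<inter> {T. is_sptree V E T s} = {}"
      using sptree_root_unique by auto
  qed (rule finite_V)
  also have "(\<Union>r\<in>V. {T. is_sptree V E T r}) = sptrees V E"
    unfolding sptrees_def is_sptree_def by auto
  finally show ?thesis
    unfolding F_G_def .
qed

end

section \<open>Walks\<close>

definition walks :: "nat \<Rightarrow> 'v set \<Rightarrow> 'v list set" where
  "walks k W = {ws. set ws \<subseteq> W \<and> length ws = k}"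

fun walk_weight :: "('v \<Rightarrow> 'v \<Rightarrow> 'a::comm_ring_1) \<Rightarrow> 'v \<Rightarrow> 'v list \<Rightarrow> 'a" where
  "walk_weight A v [] = 1"
| "walk_weight A v (w # ws) = A v w * walk_weight A w ws"

fun last_exits :: "'v \<Rightarrow> 'v list \<Rightarrow> ('v \<times> 'v) set" where
  "last_exits v [] = {}"
| "last_exits v (w # ws) = (if v \<in> set (w # ws) then {} else {(v, w)}) \<union> last_exits w ws"

text \<open>Repeated vertices account for the diagonal entries of the generator.\<close>

fun lazy_walk :: "('v \<times> 'v) set \<Rightarrow> 'v \<Rightarrow> 'v list \<Rightarrow> bool" where
  "lazy_walk E v [] = True"
| "lazy_walk E v (w # ws) = ((w = v \<or> (v, w) \<in> E) \<and> lazy_walk E w ws)"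

text \<open>Standing still must be separated: for \<open>t = r\<close> the second formula would add
  a loop. It matches the diagonal entries of the generator.\<close>

definition tree_move :: "('v \<times> 'v) set \<Rightarrow> 'v \<Rightarrow> 'v \<Rightarrow> ('v \<times> 'v) set" where
  "tree_move a r t = (if t = r then a else insert (r, t) {f \<in> a. fst f \<noteq> t})"

fun move_along :: "('v \<times> 'v) set \<Rightarrow> 'v \<Rightarrow> 'v list \<Rightarrow> ('v \<times> 'v) set" where
  "move_along a v [] = a"
| "move_along a v (w # ws) = move_along (tree_move a v w) w ws"

lemma finite_walks: "finite W \<Longrightarrow> finite (walks k W)"
  unfolding walks_def by (rule finite_lists_length_eq)

lemma walks_0 [simp]: "walks 0 W = {[]}"
  unfolding walks_def by auto

lemma sum_walks_Suc: "(\<Sum>ws\<in>walks (Suc k) W. g ws) = (\<Sum>w\<in>W. \<Sum>ws\<in>walks k W. g (w # ws))"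
proof -
  have "(\<Sum>ws\<in>walks (Suc k) W. g ws) = (\<Sum>(w, ws)\<in>W \<times> walks k W. g (w # ws))"
    by (rule sum.reindex_bij_witness[of _ "\<lambda>(w, ws). w # ws" "\<lambda>ws. (hd ws, tl ws)"])
      (auto simp: walks_def length_Suc_conv)
  then show ?thesis
    by (simp add: sum.cartesian_product)
qed

lemma entry_pow_walks:
  "entry_pow W A k u w = (\<Sum>ws\<in>walks k W. if last (u # ws) = w then walk_weight A u ws else 0)"
proof (induction k arbitrary: u)
  case (Suc k)
  have "entry_pow W A (Suc k) u w =
      (\<Sum>z\<in>W. \<Sum>ws\<in>walks k W. A u z * (if last (z # ws) = w then walk_weight A z ws else 0))"
    by (simp only: entry_pow.simps Suc sum_distrib_left)
  also have "\<dots> = (\<Sum>z\<in>W. \<Sum>ws\<in>walks k W. if last (u # z # ws) = w then walk_weight A u (z # ws) else 0)"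
    by (intro sum.cong refl) simp
  finally show ?case
    unfolding sum_walks_Suc .
qed simp

lemma lazy_walk_if_weight_nonzero:
  "walk_weight (generator E x) v ws \<noteq> 0 \<Longrightarrow> lazy_walk E v ws"
proof (induction ws arbitrary: v)
  case (Cons w ws)
  then have "generator E x v w \<noteq> 0" "walk_weight (generator E x) w ws \<noteq> 0"
    by auto
  then have "lazy_walk E w ws" "w = v \<or> (v, w) \<in> E"
    using Cons.IH by (blast, auto simp: generator_def split: if_splits)
  then show ?case
    by simp
qed simp

section \<open>Last exits and supports of walks\<close>

text \<open>The last exits form a tree on the visited vertices, directed to the endpoint. In the
  induction, a first vertex that recurs contributes nothing, and otherwise it is fresh, so its step
  is a genuine edge and cannot close a cycle.\<close>

lemma last_exits_properties:
  assumes "lazy_walk E v ws"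
  shows "last_exits v ws \<subseteq> E \<and> single_valued (last_exits v ws)
    \<and> Domain (last_exits v ws) = set (v # ws) - {last (v # ws)}
    \<and> (\<forall>u\<in>set (v # ws). (u, last (v # ws)) \<in> (last_exits v ws)\<^sup>*)"
  using assms
proof (induction ws arbitrary: v)
  case (Cons w ws)
  let ?L = "last_exits w ws" and ?S = "set (w # ws)"
  have IH: "?L \<subseteq> E" "single_valued ?L" "Domain ?L = ?S - {last (w # ws)}"
    "\<And>u. u \<in> ?S \<Longrightarrow> (u, last (w # ws)) \<in> ?L\<^sup>*"
    using Cons by auto
  have last: "last (v # w # ws) = last (w # ws)" "last (w # ws) \<in> ?S"
    by (simp, rule last_in_set) simp
  show ?case
  proof (cases "v \<in> ?S")
    case True
    then have "last_exits v (w # ws) = ?L" "set (v # w # ws) = ?S"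
      by auto
    then show ?thesis
      using IH last(1) by metis
  next
    case False
    then have L: "last_exits v (w # ws) = insert (v, w) ?L"
      by simp
    have "(v, w) \<in> E"
      using False Cons.prems by auto
    then have "insert (v, w) ?L \<subseteq> E"
      using IH(1) by blast
    moreover have "v \<notin> Domain ?L"
      using IH(3) False by auto
    then have "single_valued (insert (v, w) ?L)"
      using IH(2) unfolding single_valued_def by blast
    moreover have "Domain (insert (v, w) ?L) = set (v # w # ws) - {last (w # ws)}"
      using IH(3) False last(2) by auto
    moreover have "(u, last (w # ws)) \<in> (insert (v, w) ?L)\<^sup>*" if "u \<in> set (v # w # ws)" for u
    proof -
      have mono: "?L\<^sup>* \<subseteq> (insert (v, w) ?L)\<^sup>*"
        by (intro rtrancl_mono) auto
      show ?thesis
      proof (cases "u = v")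
        case True
        have "(w, last (w # ws)) \<in> (insert (v, w) ?L)\<^sup>*"
          using IH(4)[of w] mono by auto
        then show ?thesis
          unfolding True by (rule converse_rtrancl_into_rtrancl[rotated]) simp
      next
        case False
        then show ?thesis
          using that IH(4)[of u] mono by auto
      qed
    qed
    ultimately show ?thesis
      unfolding L last(1) by simp
  qed
qed simp

lemma lazy_walk_reach:
  assumes "lazy_walk E v ws" "set (v # ws) \<subseteq> S" "u \<in> set (v # ws)"
  shows "(v, u) \<in> (E \<inter> S \<times> S)\<^sup>* \<and> (u, last (v # ws)) \<in> (E \<inter> S \<times> S)\<^sup>*"
  using assms
proof (induction ws arbitrary: v u)
  case (Cons w ws)
  let ?R = "E \<inter> S \<times> S"
  have vw: "(v, w) \<in> ?R\<^sup>*"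
    using Cons.prems by auto
  have IH: "(w, u) \<in> ?R\<^sup>* \<and> (u, last (w # ws)) \<in> ?R\<^sup>*" if "u \<in> set (w # ws)" for u
    using Cons.IH[of w u] Cons.prems that by auto
  show ?case
  proof (cases "u \<in> set (w # ws)")
    case True
    then show ?thesis
      using IH[of u] vw by (auto intro: rtrancl_trans)
  next
    case False
    then have "u = v"
      using Cons.prems by auto
    then show ?thesis
      using IH[of w] vw by (auto intro: rtrancl_trans)
  qed
qed auto

text \<open>Each visited vertex is reached from \<open>v\<close> and leads back to it within the
  support. This puts supports of closed walks within the scope of \<open>sum_m\<close>.\<close>

lemma strongly_connected_closed_walk:
  assumes "lazy_walk E v ws" "last (v # ws) = v"
  shows "strongly_connected E (set (v # ws))"
  unfolding strongly_connected_def
proof (intro conjI ballI)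
  fix u w assume "u \<in> set (v # ws)" "w \<in> set (v # ws)"
  then show "(u, w) \<in> (E \<inter> set (v # ws) \<times> set (v # ws))\<^sup>*"
    using lazy_walk_reach[OF assms(1) subset_refl] assms(2) by (metis rtrancl_trans)
qed simp

section \<open>The tree graph\<close>

context digraph
begin

lemma tree_move_sptree:
  assumes a: "is_sptree V E a r" and t: "t = r \<or> (r, t) \<in> E"
  shows "is_sptree V E (tree_move a r t) t"
proof (cases "t = r")
  case False
  then have rt: "(r, t) \<in> E" using t by simp
  define b where "b = tree_move a r t"
  have b: "b = insert (r, t) {f \<in> a. fst f \<noteq> t}"
    using False unfolding b_def tree_move_def by simp
  have a': "r \<in> V" "a \<subseteq> E" "single_valued a" "Domain a = V - {r}"
    and reach: "\<And>u. u \<in> V \<Longrightarrow> (u, r) \<in> a\<^sup>*"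
    using a forest_reaches_root[of "{r}" a] unfolding is_sptree_iff_forest forest_iff_acyclic by auto
  have tV: "t \<in> V"
    using rt E_subset by auto
  have "is_forest V E {t} b"
  proof (rule forestI_reach)
    show "b \<subseteq> E"
      using a'(2) rt unfolding b by auto
    show "single_valued b"
      using a'(3,4) unfolding b single_valued_def by blast
    have "Domain {f \<in> a. fst f \<noteq> t} = Domain a - {t}"
      by auto
    then show "Domain b = V - {t}"
      using a'(1,4) False unfolding b Domain_insert by auto
    show "\<exists>r\<in>{t}. (u, r) \<in> b\<^sup>*" if "u \<in> V" for u
    proof -
      \<comment> \<open>The old path to \<open>r\<close> survives up to its first visit to
        \<open>t\<close>; if it misses \<open>t\<close>, the new edge is appended at
        \<open>r\<close>.\<close>
      from reach[OF that] have "(u, t) \<in> b\<^sup>*"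
      proof (induction rule: converse_rtrancl_induct)
        case base
        show ?case unfolding b by auto
      next
        case (step y z)
        show ?case
        proof (cases "y = t")
          case False
          then have "(y, z) \<in> b"
            using step.hyps unfolding b by auto
          then show ?thesis
            using step.IH by (rule converse_rtrancl_into_rtrancl)
        qed simp
      qed
      then show ?thesis by simp
    qed
  qed
  then show ?thesis
    using tV unfolding is_sptree_iff_forest b_def by simp
qed (use a in \<open>simp add: tree_move_def\<close>)

lemma move_along_sptree:
  assumes "is_sptree V E a v" "lazy_walk E v ws"
  shows "is_sptree V E (move_along a v ws) (last (v # ws))"
  using assms
proof (induction ws arbitrary: a v)
  case (Cons w ws)
  then show ?case
    using tree_move_sptree[of a v w] by simp
qed simp

lemma sptree_no_edge_from_root: "is_sptree V E a v \<Longrightarrow> (v, w) \<notin> a"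
  unfolding is_sptree_iff_forest forest_iff_acyclic by blast

text \<open>Arriving at a vertex deletes its out-edge and leaving it adds the exit, so only the last
  exit of a visited vertex survives; unvisited vertices keep their edges.\<close>

lemma move_along_eq:
  assumes "is_sptree V E a v" "lazy_walk E v ws"
  shows "move_along a v ws = {f \<in> a. fst f \<notin> set (v # ws)} \<union> last_exits v ws"
  using assms
proof (induction ws arbitrary: a v)
  case Nil
  then show ?case
    using sptree_no_edge_from_root by auto
next
  case (Cons w ws)
  have "is_sptree V E (tree_move a v w) w"
    using tree_move_sptree Cons.prems by simp
  then have "move_along a v (w # ws) =
      {f \<in> tree_move a v w. fst f \<notin> set (w # ws)} \<union> last_exits w ws"
    using Cons by simp
  also have "{f \<in> tree_move a v w. fst f \<notin> set (w # ws)} =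
      {f \<in> a. fst f \<notin> set (v # w # ws)} \<union> (if v \<in> set (w # ws) then {} else {(v, w)})"
    using sptree_no_edge_from_root[OF Cons.prems(1)] unfolding tree_move_def by auto
  finally show ?case
    by auto
qed

text \<open>By \<open>move_along_eq\<close> a tree is fixed exactly when its edges leaving the
  support are the last exits. Its other edges can be any forest rooted in the support.\<close>

lemma card_fixed_trees:
  assumes v: "v \<in> V" and ws: "set ws \<subseteq> V" "lazy_walk E v ws" "last (v # ws) = v"
  shows "card {a. is_sptree V E a v \<and> move_along a v ws = a} =
    card {b. is_forest V E (set (v # ws)) b}"
proof -
  define S where "S = set (v # ws)"
  define L where "L = last_exits v ws"
  have L: "L \<subseteq> E" "single_valued L" "Domain L = S - {v}" "\<And>u. u \<in> S \<Longrightarrow> (u, v) \<in> L\<^sup>*"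
    using last_exits_properties[OF ws(2)] unfolding ws(3) L_def S_def by blast+
  have S: "v \<in> S" "S \<subseteq> V"
    using v ws(1) unfolding S_def by auto
  have "{a. is_sptree V E a v \<and> move_along a v ws = a} =
      {a. is_sptree V E a v \<and> {f \<in> a. fst f \<notin> S} \<union> L = a}"
    using move_along_eq[OF _ ws(2)] unfolding S_def L_def by auto
  moreover have bij: "bij_betw (\<lambda>a. {f \<in> a. fst f \<notin> S})
      {a. is_sptree V E a v \<and> {f \<in> a. fst f \<notin> S} \<union> L = a} {b. is_forest V E S b}"
  proof (rule bij_betw_byWitness[where f' = "\<lambda>b. b \<union> L"])
    show "\<forall>a\<in>{a. is_sptree V E a v \<and> {f \<in> a. fst f \<notin> S} \<union> L = a}. {f \<in> a. fst f \<notin> S} \<union> L = a"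
      by blast
    have restr: "{f \<in> b \<union> L. fst f \<notin> S} = b" if b: "is_forest V E S b" for b
    proof -
      have "Domain b = V - S"
        using b forest_iff_acyclic by blast
      then have "fst f \<notin> S" if "f \<in> b" for f
        using that by (metis DiffD2 DomainI prod.collapse)
      moreover have "fst f \<in> S" if "f \<in> L" for f
        using that L(3) by (metis DiffD1 DomainI prod.collapse)
      ultimately show ?thesis
        by blast
    qed
    then show "\<forall>b\<in>{b. is_forest V E S b}. {f \<in> b \<union> L. fst f \<notin> S} = b"
      by blast
    show "(\<lambda>a. {f \<in> a. fst f \<notin> S}) ` {a. is_sptree V E a v \<and> {f \<in> a. fst f \<notin> S} \<union> L = a} \<subseteq>
        {b. is_forest V E S b}"
      using forest_restrict[of "{v}" _ S] S(1) is_sptree_iff_forest by auto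
    show "(\<lambda>b. b \<union> L) ` {b. is_forest V E S b} \<subseteq>
        {a. is_sptree V E a v \<and> {f \<in> a. fst f \<notin> S} \<union> L = a}"
    proof (rule image_subsetI)
      fix b assume "b \<in> {b. is_forest V E S b}"
      then have forest: "is_forest V E S b" by simp
      then have b: "b \<subseteq> E" "single_valued b" "Domain b = V - S"
        using forest_iff_acyclic by auto
      have "is_forest V E {v} (b \<union> L)"
      proof (rule forestI_reach)
        show "b \<union> L \<subseteq> E"
          using b(1) L(1) by blast
        show "Domain (b \<union> L) = V - {v}"
          using b(3) L(3) S unfolding Domain_Un_eq by auto
        have "Domain b \<inter> Domain L = {}"
          using b(3) L(3) by auto
        then show "single_valued (b \<union> L)"
          using b(2) L(2) unfolding single_valued_def by blast
        show "\<exists>r\<in>{v}. (u, r) \<in> (b \<union> L)\<^sup>*" if u: "u \<in> V" for u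
        proof -
          obtain r where r: "r \<in> S" "(u, r) \<in> b\<^sup>*"
            using forest_reaches_root[OF forest u] by blast
          have "(u, r) \<in> (b \<union> L)\<^sup>*"
            using r(2) rtrancl_mono[of b "b \<union> L"] by auto
          moreover have "(r, v) \<in> (b \<union> L)\<^sup>*"
            using L(4)[OF r(1)] rtrancl_mono[of L "b \<union> L"] by auto
          ultimately show ?thesis by auto
        qed
      qed
      then show "b \<union> L \<in> {a. is_sptree V E a v \<and> {f \<in> a. fst f \<notin> S} \<union> L = a}"
        using v restr[OF forest] is_sptree_iff_forest by simp
    qed
  qed
  ultimately show ?thesis
    using bij_betw_same_card[OF bij] unfolding S_def by simp
qed

section \<open>The generator of the tree graph as a lift, and its traces\<close>

lemma tg_edges_iff:
  assumes "is_sptree V E a r"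
  shows "(a, b) \<in> tg_edges V E \<longleftrightarrow> (\<exists>t. (r, t) \<in> E \<and> b = tree_move a r t)"
proof -
  have "(a, b) \<in> tg_edges V E \<longleftrightarrow> (\<exists>e\<in>E. fst e = r \<and> b = insert e (a - {f \<in> a. fst f = snd e}))"
    using assms sptree_root_unique unfolding tg_edges_def by blast
  also have "\<dots> \<longleftrightarrow> (\<exists>t. (r, t) \<in> E \<and> b = insert (r, t) (a - {f \<in> a. fst f = t}))"
    by force
  also have "\<dots> \<longleftrightarrow> (\<exists>t. (r, t) \<in> E \<and> b = tree_move a r t)"
  proof -
    have "insert (r, t) (a - {f \<in> a. fst f = t}) = tree_move a r t" if "(r, t) \<in> E" for t
      using that no_loops unfolding tree_move_def by auto
    then show ?thesis by metis
  qed
  finally show ?thesis .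
qed

sublocale tree_graph: finite_digraph "sptrees V E" "tg_edges V E"
proof
  show "tg_edges V E \<subseteq> sptrees V E \<times> sptrees V E"
  proof
    fix p assume p: "p \<in> tg_edges V E"
    then obtain a b r where ab: "p = (a, b)" "is_sptree V E a r"
      unfolding tg_edges_def by auto
    then obtain t where "(r, t) \<in> E" "b = tree_move a r t"
      using p tg_edges_iff by blast
    then show "p \<in> sptrees V E \<times> sptrees V E"
      using ab tree_move_sptree unfolding sptrees_def by blast
  qed
qed (rule finite_sptrees)

text \<open>The root has no out-edge in \<open>a\<close>, so the added edge is recoverable. This
  resolves the description in \<open>tg_weight\<close> and shows that different edges at the root
  give different trees.\<close>

lemma tree_move_diff:
  assumes "is_sptree V E a r" "(r, t) \<in> E"
  shows "tree_move a r t - a = {(r, t)}"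
  using sptree_no_edge_from_root[OF assms(1)] assms(2) no_loops unfolding tree_move_def by auto

lemma tg_weight_tree_move:
  assumes "is_sptree V E a r" "(r, t) \<in> E"
  shows "tg_weight x (a, tree_move a r t) = x (r, t)"
  unfolding tg_weight_def using tree_move_diff[OF assms] by simp

lemma inj_on_tree_move:
  assumes "is_sptree V E a r"
  shows "inj_on (tree_move a r) {t. (r, t) \<in> E}"
proof (rule inj_onI)
  fix t t' assume "t \<in> {t. (r, t) \<in> E}" "t' \<in> {t. (r, t) \<in> E}" "tree_move a r t = tree_move a r t'"
  then have "{(r, t)} = {(r, t')}"
    using tree_move_diff[OF assms] by (metis mem_Collect_eq)
  then show "t = t'" by simp
qed

text \<open>The row of \<open>a\<close> is the push-forward of the row of its root. On the diagonal,
  injectivity of \<open>tree_move a r\<close> on the edges at \<open>r\<close> makes the out-weights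
  of \<open>a\<close> and \<open>r\<close> equal, and the stay \<open>w = r\<close> contributes
  exactly at \<open>b = a\<close>.\<close>

lemma generator_tree_graph:
  fixes x :: "'v \<times> 'v \<Rightarrow> 'a::comm_ring_1"
  assumes a: "is_sptree V E a r"
  shows "generator (tg_edges V E) (tg_weight x) a b =
    (\<Sum>w\<in>V. if tree_move a r w = b then generator E x r w else 0)"
proof -
  let ?out = "\<Sum>t | (r, t) \<in> E. x (r, t)"
  have rV: "r \<in> V"
    using a unfolding is_sptree_def by simp
  have edges: "{b. (a, b) \<in> tg_edges V E} = tree_move a r ` {t. (r, t) \<in> E}"
    using tg_edges_iff[OF a] by auto
  have out: "(\<Sum>b | (a, b) \<in> tg_edges V E. tg_weight x (a, b)) = ?out"
    unfolding edges sum.reindex[OF inj_on_tree_move[OF a]]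
    using tg_weight_tree_move[OF a] by (intro sum.cong) auto
  have edge: "(\<Sum>w\<in>V. if tree_move a r w = b \<and> (r, w) \<in> E then x (r, w) else 0) =
      (if (a, b) \<in> tg_edges V E then tg_weight x (a, b) else 0)"
  proof (cases "(a, b) \<in> tg_edges V E")
    case True
    then obtain t where t: "(r, t) \<in> E" "b = tree_move a r t"
      using tg_edges_iff[OF a] by blast
    have "(\<Sum>w\<in>V. if tree_move a r w = b \<and> (r, w) \<in> E then x (r, w) else 0) =
        (\<Sum>w\<in>V. if w = t then x (r, t) else 0)"
      using inj_onD[OF inj_on_tree_move[OF a]] t by (intro sum.cong) auto
    also have "\<dots> = x (r, t)"
      using t(1) E_subset finite_V by auto
    finally show ?thesis
      using True tg_weight_tree_move[OF a t(1), of x] t(2) by simp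
  next
    case False
    then show ?thesis
      using tg_edges_iff[OF a] by (auto intro!: sum.neutral)
  qed
  have "(\<Sum>w\<in>V. if tree_move a r w = b then generator E x r w else 0) =
      (\<Sum>w\<in>V. (if tree_move a r w = b \<and> (r, w) \<in> E then x (r, w) else 0)
        - (if w = r then (if a = b then ?out else 0) else 0))"
    by (intro sum.cong) (auto simp: generator_def tree_move_def)
  also have "\<dots> = (if (a, b) \<in> tg_edges V E then tg_weight x (a, b) else 0)
      - (if a = b then ?out else 0)"
    unfolding sum_subtractf edge using rV finite_V by simp
  also have "\<dots> = generator (tg_edges V E) (tg_weight x) a b"
    unfolding generator_def out ..
  finally show ?thesis ..
qed

text \<open>Unique lifting: a walk of the root together with the initial tree determines all later
  trees, and the weight does not change.\<close>

lemma entry_pow_tree_graph: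
  fixes x :: "'v \<times> 'v \<Rightarrow> 'a::comm_ring_1"
  assumes "is_sptree V E a v"
  shows "entry_pow (sptrees V E) (generator (tg_edges V E) (tg_weight x)) k a b =
    (\<Sum>ws\<in>walks k V. if move_along a v ws = b then walk_weight (generator E x) v ws else 0)"
  using assms
proof (induction k arbitrary: a v)
  case (Suc k)
  let ?A = "generator E x" and ?B = "generator (tg_edges V E) (tg_weight x)"
  let ?P = "\<lambda>c. entry_pow (sptrees V E) ?B k c b"
  have "entry_pow (sptrees V E) ?B (Suc k) a b =
      (\<Sum>c\<in>sptrees V E. (\<Sum>w\<in>V. if tree_move a v w = c then ?A v w else 0) * ?P c)"
    by (simp add: generator_tree_graph[OF Suc.prems])
  also have "\<dots> = (\<Sum>w\<in>V. \<Sum>c\<in>sptrees V E. if tree_move a v w = c then ?A v w * ?P c else 0)"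
    unfolding sum_distrib_right by (subst sum.swap) (intro sum.cong refl, simp)
  also have "\<dots> = (\<Sum>w\<in>V. \<Sum>ws\<in>walks k V.
      if move_along a v (w # ws) = b then walk_weight ?A v (w # ws) else 0)"
  proof (rule sum.cong[OF refl])
    fix w assume "w \<in> V"
    show "(\<Sum>c\<in>sptrees V E. if tree_move a v w = c then ?A v w * ?P c else 0) =
        (\<Sum>ws\<in>walks k V. if move_along a v (w # ws) = b then walk_weight ?A v (w # ws) else 0)"
    \<comment> \<open>A step of weight zero need not lead to a tree, so the induction hypothesis is
      used only for the others.\<close>
    proof (cases "?A v w = 0")
      case False
      then have "w = v \<or> (v, w) \<in> E"
        unfolding generator_def by (auto split: if_splits)
      then have tree: "is_sptree V E (tree_move a v w) w"
        using tree_move_sptree Suc.prems by blast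
      then have "tree_move a v w \<in> sptrees V E"
        unfolding sptrees_def by blast
      then have "(\<Sum>c\<in>sptrees V E. if tree_move a v w = c then ?A v w * ?P c else 0) =
          ?A v w * ?P (tree_move a v w)"
        using finite_sptrees by simp
      also have "\<dots> = (\<Sum>ws\<in>walks k V. ?A v w *
          (if move_along (tree_move a v w) w ws = b then walk_weight ?A w ws else 0))"
        unfolding Suc.IH[OF tree] sum_distrib_left ..
      also have "\<dots> = (\<Sum>ws\<in>walks k V. if move_along a v (w # ws) = b then walk_weight ?A v (w # ws) else 0)"
        by (intro sum.cong refl) simp
      finally show ?thesis .
    qed (auto intro!: sum.neutral)
  qed
  finally show ?case
    unfolding sum_walks_Suc .
qed simp

lemma trace_tree_graph:
  fixes x :: "'v \<times> 'v \<Rightarrow> 'a::comm_ring_1"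
  shows "(\<Sum>a\<in>sptrees V E. entry_pow (sptrees V E) (generator (tg_edges V E) (tg_weight x)) k a a) =
    (\<Sum>W\<in>sc_sets. of_nat (m V E W) * (\<Sum>v\<in>W. entry_pow W (generator E x) k v v))"
proof -
  let ?A = "generator E x" and ?B = "generator (tg_edges V E) (tg_weight x)"
  let ?wt = "walk_weight ?A"
  have "(\<Sum>a\<in>sptrees V E. entry_pow (sptrees V E) ?B k a a) =
      (\<Sum>a\<in>(\<Union>v\<in>V. {a. is_sptree V E a v}). entry_pow (sptrees V E) ?B k a a)"
    by (intro sum.cong) (auto simp: sptrees_def is_sptree_def)
  also have "\<dots> = (\<Sum>v\<in>V. \<Sum>a | is_sptree V E a v. entry_pow (sptrees V E) ?B k a a)"
    using finite_V finite_rooted_trees sptree_root_unique by (intro sum.UNION_disjoint) auto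
  also have "\<dots> = (\<Sum>v\<in>V. \<Sum>a | is_sptree V E a v. \<Sum>ws\<in>walks k V.
      if move_along a v ws = a then ?wt v ws else 0)"
    by (intro sum.cong refl entry_pow_tree_graph) simp
  also have "\<dots> = (\<Sum>v\<in>V. \<Sum>ws\<in>walks k V. \<Sum>a | is_sptree V E a v.
      if move_along a v ws = a then ?wt v ws else 0)"
    by (intro sum.cong refl sum.swap)
  also have "\<dots> = (\<Sum>v\<in>V. \<Sum>ws\<in>walks k V.
      of_nat (card {a. is_sptree V E a v \<and> move_along a v ws = a}) * ?wt v ws)"
  proof (intro sum.cong refl)
    fix v ws
    have "(\<Sum>a | is_sptree V E a v. if move_along a v ws = a then ?wt v ws else 0) =
        (\<Sum>a\<in>{a \<in> {a. is_sptree V E a v}. move_along a v ws = a}. ?wt v ws)"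
      by (rule sum.inter_filter[OF finite_rooted_trees, symmetric])
    then show "(\<Sum>a | is_sptree V E a v. if move_along a v ws = a then ?wt v ws else 0) =
        of_nat (card {a. is_sptree V E a v \<and> move_along a v ws = a}) * ?wt v ws"
      by simp
  qed
  also have "\<dots> = (\<Sum>v\<in>V. \<Sum>ws\<in>walks k V. \<Sum>W\<in>sc_sets.
      if set (v # ws) \<subseteq> W \<and> last (v # ws) = v then of_nat (m V E W) * ?wt v ws else 0)"
  proof (intro sum.cong refl)
    fix v ws assume v: "v \<in> V" and "ws \<in> walks k V"
    then have ws: "set ws \<subseteq> V"
      unfolding walks_def by simp
    show "of_nat (card {a. is_sptree V E a v \<and> move_along a v ws = a}) * ?wt v ws =
        (\<Sum>W\<in>sc_sets. if set (v # ws) \<subseteq> W \<and> last (v # ws) = v then of_nat (m V E W) * ?wt v ws else 0)"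
    proof (cases "?wt v ws = 0")
      case False
      then have walk: "lazy_walk E v ws"
        by (rule lazy_walk_if_weight_nonzero)
      show ?thesis
      proof (cases "last (v # ws) = v")
        case True
        \<comment> \<open>Here the two counts meet: \<open>card_fixed_trees\<close> and
          \<open>sum_m\<close> both count the forests rooted in the support of the closed
          walk.\<close>
        have "card {a. is_sptree V E a v \<and> move_along a v ws = a} =
            (\<Sum>W\<in>{W \<in> sc_sets. set (v # ws) \<subseteq> W}. m V E W)"
          using card_fixed_trees[OF v ws walk True] sum_m[OF strongly_connected_closed_walk[OF walk True]]
            v ws by simp
        also have "\<dots> = (\<Sum>W\<in>sc_sets. if set (v # ws) \<subseteq> W then m V E W else 0)"
          by (rule sum.inter_filter[OF finite_sc_sets])
        finally have "of_nat (card {a. is_sptree V E a v \<and> move_along a v ws = a}) * ?wt v ws =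
            (\<Sum>W\<in>sc_sets. of_nat (if set (v # ws) \<subseteq> W then m V E W else 0) * ?wt v ws)"
          by (simp only: of_nat_sum sum_distrib_right)
        also have "\<dots> = (\<Sum>W\<in>sc_sets. if set (v # ws) \<subseteq> W \<and> last (v # ws) = v
            then of_nat (m V E W) * ?wt v ws else 0)"
          using True by (intro sum.cong refl) (simp del: last.simps)
        finally show ?thesis .
      next
        case False
        \<comment> \<open>A walk that is not closed changes the root and so fixes no tree.\<close>
        then have "{a. is_sptree V E a v \<and> move_along a v ws = a} = {}"
          using move_along_sptree[OF _ walk] sptree_root_unique by fastforce
        then have "card {a. is_sptree V E a v \<and> move_along a v ws = a} = 0"
          by (simp only: card.empty)
        then show ?thesis
          using False by (simp del: last.simps)
      qed
    qed (simp add: sum.neutral)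
  qed
  also have "\<dots> = (\<Sum>v\<in>V. \<Sum>W\<in>sc_sets. \<Sum>ws\<in>walks k V.
      if set (v # ws) \<subseteq> W \<and> last (v # ws) = v then of_nat (m V E W) * ?wt v ws else 0)"
    by (intro sum.cong refl sum.swap)
  also have "\<dots> = (\<Sum>W\<in>sc_sets. \<Sum>v\<in>V. \<Sum>ws\<in>walks k V.
      if set (v # ws) \<subseteq> W \<and> last (v # ws) = v then of_nat (m V E W) * ?wt v ws else 0)"
    by (rule sum.swap)
  also have "\<dots> = (\<Sum>W\<in>sc_sets. of_nat (m V E W) * (\<Sum>v\<in>W. entry_pow W ?A k v v))"
  proof (rule sum.cong[OF refl])
    fix W assume "W \<in> sc_sets"
    then have W: "W \<subseteq> V" "finite W"
      using finite_V finite_subset by auto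
    have "(\<Sum>v\<in>V. \<Sum>ws\<in>walks k V.
        if set (v # ws) \<subseteq> W \<and> last (v # ws) = v then of_nat (m V E W) * ?wt v ws else 0) =
        (\<Sum>(v, ws)\<in>V \<times> walks k V.
        if set (v # ws) \<subseteq> W \<and> last (v # ws) = v then of_nat (m V E W) * ?wt v ws else 0)"
      by (rule sum.cartesian_product)
    \<comment> \<open>Terms whose support leaves \<open>W\<close> vanish; what remains are the
      closed walks in \<open>W\<close>, that is, the trace for the restricted generator.\<close>
    also have "\<dots> = (\<Sum>(v, ws)\<in>W \<times> walks k W.
        if last (v # ws) = v then of_nat (m V E W) * ?wt v ws else 0)"
    proof (rule sum.mono_neutral_cong_right)
      show "finite (V \<times> walks k V)"
        using finite_V finite_walks by blast
    qed (use W(1) in \<open>auto simp: walks_def simp del: last.simps split: if_splits\<close>)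
    also have "\<dots> = (\<Sum>v\<in>W. \<Sum>ws\<in>walks k W.
        if last (v # ws) = v then of_nat (m V E W) * ?wt v ws else 0)"
      by (rule sum.cartesian_product[symmetric])
    also have "\<dots> = of_nat (m V E W) * (\<Sum>v\<in>W. entry_pow W ?A k v v)"
      unfolding entry_pow_walks sum_distrib_left by (intro sum.cong refl) simp
    finally show "(\<Sum>v\<in>V. \<Sum>ws\<in>walks k V.
        if set (v # ws) \<subseteq> W \<and> last (v # ws) = v then of_nat (m V E W) * ?wt v ws else 0) =
        of_nat (m V E W) * (\<Sum>v\<in>W. entry_pow W ?A k v v)" .
  qed
  finally show ?thesis .
qed

lemma F_TG_complex:
  fixes x :: "'v \<times> 'v \<Rightarrow> complex"
  assumes "strongly_connected E V"
  shows "F_TG V E x = Phi_G V E x * F_G V E x"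
proof -
  define Q where "Q W = char_poly (mat_of W (generator E x))" for W
  define X where "X = {W. W \<subset> V \<and> strongly_connected E W}"
  have finX: "finite X"
    by (rule finite_subset[OF _ finite_sc_sets]) (auto simp: X_def)
  have sc: "sc_sets = insert V X" "V \<notin> X"
    unfolding X_def using assms by auto
  have V: "V \<noteq> {}"
    using assms unfolding strongly_connected_def by blast
  have Q0: "coeff (Q W) 0 = Psi V E x (V - W)" if "W \<subseteq> V" for W
    unfolding Q_def using that by (rule coeff_0_char_poly_generator)
  have "char_poly (mat_of (sptrees V E) (generator (tg_edges V E) (tg_weight x))) =
      (\<Prod>W\<in>sc_sets. Q W ^ m V E W)"
    unfolding Q_def using finite_V
    by (intro char_poly_eq_prod_char_polys trace_tree_graph finite_sptrees finite_sc_sets)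
      (auto intro: finite_subset)
  also have "\<dots> = Q V * (\<Prod>W\<in>X. Q W ^ m V E W)"
    unfolding sc(1) using finX sc(2) m_V[OF assms] by simp
  finally have "F_G (sptrees V E) (tg_edges V E) (tg_weight x) =
      coeff (Q V * (\<Prod>W\<in>X. Q W ^ m V E W)) 1"
    using tree_graph.coeff_1_char_poly_generator[of "tg_weight x"] by simp
  \<comment> \<open>The first of the two terms drops out, since the constant coefficient of
    \<open>Q V\<close> counts forests without roots.\<close>
  also have "\<dots> = coeff (Q V) 0 * coeff (\<Prod>W\<in>X. Q W ^ m V E W) 1 +
      coeff (Q V) 1 * coeff (\<Prod>W\<in>X. Q W ^ m V E W) 0"
    by (simp add: coeff_mult)
  also have "coeff (Q V) 0 = 0"
    using Q0[of V] Psi_empty[OF V, of x] by simp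
  also have "coeff (Q V) 1 = F_G V E x"
    unfolding Q_def by (rule coeff_1_char_poly_generator)
  also have "coeff (\<Prod>W\<in>X. Q W ^ m V E W) 0 = (\<Prod>W\<in>X. Psi V E x (V - W) ^ m V E W)"
    unfolding poly_0_coeff_0[symmetric] poly_prod poly_power
    by (intro prod.cong refl) (auto simp: poly_0_coeff_0 Q0 X_def)
  also have "\<dots> = Phi_G V E x"
    unfolding Phi_G_def X_def ..
  also have "F_G (sptrees V E) (tg_edges V E) (tg_weight x) = F_TG V E x"
    unfolding F_TG_def F_G_def ..
  finally show ?thesis by simp
qed

end

section \<open>Transfer to commutative semirings\<close>

text \<open>A polynomial with natural coefficients: the inner multisets are monomials, and a
  coefficient is a multiplicity in the outer one.\<close>

definition monomial_sum :: "'e multiset multiset \<Rightarrow> ('e \<Rightarrow> 'a::comm_semiring_1) \<Rightarrow> 'a" where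
  "monomial_sum M x = (\<Sum>p\<in>#M. \<Prod>e\<in>#p. x e)"

text \<open>One formal polynomial evaluated in two semirings. The closure rules below supply
  \<open>M\<close> without ever writing it down.\<close>

definition same_polynomial ::
  "(('e \<Rightarrow> 'a::comm_semiring_1) \<Rightarrow> 'a) \<Rightarrow> (('e \<Rightarrow> 'b::comm_semiring_1) \<Rightarrow> 'b) \<Rightarrow> bool" where
  "same_polynomial f g \<longleftrightarrow> (\<exists>M. f = monomial_sum M \<and> g = monomial_sum M)"

lemma same_polynomial_var: "same_polynomial (\<lambda>x. x e) (\<lambda>x. x e)"
  unfolding same_polynomial_def
  by (rule exI[of _ "{#{#e#}#}"]) (simp add: monomial_sum_def fun_eq_iff)

lemma same_polynomial_0: "same_polynomial (\<lambda>x. 0) (\<lambda>x. 0)"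
  unfolding same_polynomial_def
  by (rule exI[of _ "{#}"]) (simp add: monomial_sum_def fun_eq_iff)

lemma same_polynomial_1: "same_polynomial (\<lambda>x. 1) (\<lambda>x. 1)"
  unfolding same_polynomial_def
  by (rule exI[of _ "{#{#}#}"]) (simp add: monomial_sum_def fun_eq_iff)

lemma same_polynomial_add:
  assumes "same_polynomial f g" "same_polynomial f' g'"
  shows "same_polynomial (\<lambda>x. f x + f' x) (\<lambda>x. g x + g' x)"
proof -
  obtain M M' where "f = monomial_sum M" "g = monomial_sum M"
    "f' = monomial_sum M'" "g' = monomial_sum M'"
    using assms unfolding same_polynomial_def by blast
  then show ?thesis
    unfolding same_polynomial_def
    by (intro exI[of _ "M + M'"]) (simp add: monomial_sum_def fun_eq_iff)
qed

lemma monomial_sum_mult: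
  "monomial_sum M x * monomial_sum M' x =
    monomial_sum (\<Sum>p\<in>#M. image_mset ((+) p) M') x"
proof (induction M)
  case (add p M)
  have add_mset: "monomial_sum (add_mset p M) x = (\<Prod>e\<in>#p. x e) + monomial_sum M x"
    and plus: "monomial_sum (K + L) x = monomial_sum K x + monomial_sum L x" for K L
    unfolding monomial_sum_def by simp_all
  have "(\<Prod>e\<in>#p. x e) * monomial_sum M' x = monomial_sum (image_mset ((+) p) M') x"
    unfolding monomial_sum_def by (simp add: sum_mset_distrib_left multiset.map_comp comp_def)
  then show ?case
    using add by (simp add: add_mset plus distrib_right)
qed (simp add: monomial_sum_def)

lemma same_polynomial_mult:
  assumes "same_polynomial f g" "same_polynomial f' g'"
  shows "same_polynomial (\<lambda>x. f x * f' x) (\<lambda>x. g x * g' x)"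
proof -
  obtain M M' where "f = monomial_sum M" "g = monomial_sum M"
    "f' = monomial_sum M'" "g' = monomial_sum M'"
    using assms unfolding same_polynomial_def by blast
  then show ?thesis
    unfolding same_polynomial_def
    by (intro exI[of _ "\<Sum>p\<in>#M. image_mset ((+) p) M'"]) (simp add: monomial_sum_mult fun_eq_iff)
qed

lemma same_polynomial_sum:
  assumes "\<And>i. i \<in> A \<Longrightarrow> same_polynomial (f i) (g i)"
  shows "same_polynomial (\<lambda>x. \<Sum>i\<in>A. f i x) (\<lambda>x. \<Sum>i\<in>A. g i x)"
  using assms
  by (induction A rule: infinite_finite_induct)
    (simp_all add: same_polynomial_0 same_polynomial_add)

lemma same_polynomial_prod:
  assumes "\<And>i. i \<in> A \<Longrightarrow> same_polynomial (f i) (g i)"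
  shows "same_polynomial (\<lambda>x. \<Prod>i\<in>A. f i x) (\<lambda>x. \<Prod>i\<in>A. g i x)"
  using assms
  by (induction A rule: infinite_finite_induct)
    (simp_all add: same_polynomial_1 same_polynomial_mult)

lemma same_polynomial_power:
  assumes "same_polynomial f g"
  shows "same_polynomial (\<lambda>x. f x ^ n) (\<lambda>x. g x ^ n)"
  by (induction n) (simp_all add: same_polynomial_1 same_polynomial_mult assms)

section \<open>Recovering a polynomial from its complex values\<close>

lemma image_mset_inj_onD:
  assumes "inj_on f S" "set_mset A \<subseteq> S" "set_mset B \<subseteq> S" "image_mset f A = image_mset f B"
  shows "A = B"
proof -
  have "image_mset (inv_into S f) (image_mset f K) = K" if "set_mset K \<subseteq> S" for K
  proof -
    have "image_mset (\<lambda>z. inv_into S f (f z)) K = image_mset (\<lambda>z. z) K"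
      using that assms(1) by (intro image_mset_cong inv_into_f_f) auto
    then show ?thesis
      by (simp add: multiset.map_comp comp_def)
  qed
  then show ?thesis
    using assms(2-4) by metis
qed

text \<open>Evaluating at powers of distinct primes separates the monomials.\<close>

lemma monomial_sum_inject:
  fixes M N :: "'e multiset multiset"
  assumes eq: "\<And>x :: 'e \<Rightarrow> complex. monomial_sum M x = monomial_sum N x"
  shows "M = N"
proof -
  define S where "S = (\<Union>p\<in>set_mset (M + N). set_mset p)"
  have "finite S"
    unfolding S_def by simp
  then obtain g :: "'e \<Rightarrow> nat" where g: "inj_on g S"
    by (auto dest: finite_imp_inj_to_nat_seg)
  obtain h :: "nat \<Rightarrow> nat" where h: "inj h" "range h \<subseteq> {p. prime p}"
    using primes_infinite unfolding infinite_iff_countable_subset by auto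
  define f where "f = h \<circ> g"
  have f: "f ` S \<subseteq> {p. prime p}" "inj_on f S"
    unfolding f_def using h g by (auto intro!: comp_inj_on intro: inj_on_subset)
  \<comment> \<open>The value of a monomial at the primes chosen by \<open>f\<close>; unique
    factorization makes it injective on the occurring monomials.\<close>
  define v where "v p = (\<Prod>e\<in>#p. f e)" for p
  have inj: "p = q" if "p \<in># M + N" "q \<in># M + N" "v p = v q" for p q
  proof -
    have fact: "prime_factorization (v r) = image_mset f r" if "r \<in># M + N" for r
    proof -
      have "set_mset r \<subseteq> S"
        using that unfolding S_def by blast
      then have "\<And>e. e \<in># image_mset f r \<Longrightarrow> prime e"
        using f(1) by auto
      then show ?thesis
        unfolding v_def by (rule prime_factorization_prod_mset_primes)
    qed
    have "image_mset f p = image_mset f q"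
      using fact that by metis
    moreover have "set_mset p \<subseteq> S" "set_mset q \<subseteq> S"
      using that unfolding S_def by blast+
    ultimately show ?thesis
      using image_mset_inj_onD[OF f(2)] by blast
  qed
  let ?v = "\<lambda>p. complex_of_nat (v p)"
  \<comment> \<open>Power sums of the monomial values are evaluations at the points
    \<open>f e ^ k\<close>, so the assumed equality applies to each of them.\<close>
  have pow: "(\<Sum>z\<in>#image_mset ?v K. z ^ k) = monomial_sum K (\<lambda>e. complex_of_nat (f e) ^ k)"
    for K k
  proof -
    have "?v p ^ k = (\<Prod>e\<in>#p. complex_of_nat (f e) ^ k)" for p
      unfolding v_def by (induction p) (simp_all add: power_mult_distrib)
    then show ?thesis
      unfolding monomial_sum_def by (simp add: multiset.map_comp comp_def)
  qed
  have "image_mset ?v M = image_mset ?v N"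
    by (rule power_sums_determine_multiset) (simp only: pow eq)
  moreover have "inj_on ?v (set_mset (M + N))"
    using inj by (auto intro!: inj_onI)
  ultimately show ?thesis
    by (intro image_mset_inj_onD[of ?v "set_mset (M + N)"]) auto
qed

text \<open>Equal complex evaluations force the two formal polynomials to coincide, hence also their
  values in the other semiring.\<close>

lemma same_polynomial_transfer:
  fixes f f' :: "('e \<Rightarrow> complex) \<Rightarrow> complex"
  assumes "same_polynomial f g" "same_polynomial f' g'" "f = f'"
  shows "g = g'"
  using assms monomial_sum_inject unfolding same_polynomial_def by metis

lemma same_polynomial_F_G: "same_polynomial (F_G V E) (F_G V E)"
  unfolding F_G_def weight_def
  by (intro same_polynomial_sum same_polynomial_prod same_polynomial_var)

text \<open>The edge described in \<open>tg_weight\<close> does not depend on \<open>x\<close>, so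
  each edge weight of the tree graph is a single variable.\<close>

lemma same_polynomial_F_TG: "same_polynomial (F_TG V E) (F_TG V E)"
  unfolding F_TG_def weight_def tg_weight_def
  by (intro same_polynomial_sum same_polynomial_prod same_polynomial_var)

lemma same_polynomial_Phi_G: "same_polynomial (Phi_G V E) (Phi_G V E)"
  unfolding Phi_G_def Psi_def weight_def
  by (intro same_polynomial_sum same_polynomial_prod same_polynomial_power same_polynomial_var)

theorem theorem3p3:
  fixes V :: "'v::linorder set" and E :: "('v \<times> 'v) set"
    and x :: "'v \<times> 'v \<Rightarrow> 'a::comm_semiring_1"
  assumes "simple_digraph V E" and "strongly_connected E V"
  shows "F_TG V E x = Phi_G V E x * F_G V E x"
proof -
  interpret digraph V E
    using assms(1) unfolding simple_digraph_def by unfold_locales auto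
  \<comment> \<open>The identity is stated between functions of \<open>x\<close>: a single
    evaluation would not determine the polynomial.\<close>
  have "(F_TG V E :: ('v \<times> 'v \<Rightarrow> complex) \<Rightarrow> complex) = (\<lambda>x. Phi_G V E x * F_G V E x)"
    using F_TG_complex[OF assms(2)] by (rule ext)
  then have "(F_TG V E :: ('v \<times> 'v \<Rightarrow> 'a) \<Rightarrow> 'a) = (\<lambda>x. Phi_G V E x * F_G V E x)"
    by (rule same_polynomial_transfer[OF same_polynomial_F_TG
        same_polynomial_mult[OF same_polynomial_Phi_G same_polynomial_F_G]])
  then show ?thesis
    by (rule fun_cong)
qed

end
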